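(* Let $b$ be a prime, $m\in\mathbb{N}$, $N=b^m$, $s\in\mathbb{N}$, $\alpha>1$, let $(\gamma_{\mathfrak{u}})_{\mathfrak{u}\subseteq[s]}$ be positive weights with $\gamma_\emptyset=1$, let $0\le w_1\le\cdots\le w_s$ be integers, and put $Y_j=Y_j(x)=x^{w_j}\in\mathbb{F}_b[x]$. Let $\boldsymbol{g}=(Y_1g_1,\ldots,Y_sg_s)$ be constructed by the reduced successive coordinate search (SCS) algorithm for polynomial lattice rules with modulus $x^m$ (defined in the context) from some starting vector $\boldsymbol{g}^0\in\{g\in\mathbb{F}_b[x]:\deg(g)<m\}^s$. Then, for every $\lambda\in(\frac1\alpha,1]$, the squared worst-case error in the weighted Walsh space satisfies $$e_{N,s}^2\big((Y_1g_1,\ldots,Y_sg_s)\big)\le\left(\sum_{d=1}^s\ \sum_{d\in\mathfrak{u}\subseteq[s]}\gamma_{\mathfrak{u}}^\lambda\,\frac{2\,(\mu_b(\alpha\lambda))^{|\mathfrak{u}|}}{b^{\max(0,m-w_d)}}\right)^{1/\lambda}.$$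
   Context: Notation: $[s]=\{1,\ldots,s\}$; for a vector $\boldsymbol{x}$ and $\mathfrak{u}\subseteq[s]$, $\boldsymbol{x}_{\mathfrak{u}}=(x_j)_{j\in\mathfrak{u}}$; $\mathbb{F}_b$ is the field with $b$ elements, identified with $\{0,\ldots,b-1\}$. For $h\in\mathbb{N}$, $\psi_b(h)=\lfloor\log_b h\rfloor$ and $r_\alpha(h)=b^{-\alpha\psi_b(h)}$; for vectors $r_\alpha(\boldsymbol{h})=\prod_j r_\alpha(h_j)$. For $\beta>1$, $\mu_b(\beta)=\sum_{h=1}^\infty r_\beta(h)=\frac{b^\beta(b-1)}{b^\beta-b}$. Walsh functions: for $h=h_0+h_1b+\cdots+h_ab^a$ (base-$b$ digits) and $x=\frac{x_1}{b}+\frac{x_2}{b^2}+\cdots\in[0,1)$ (with infinitely many digits $x_i\neq b-1$), $\mathrm{wal}_h(x)=\mathrm{e}^{2\pi\mathrm{i}(x_1h_0+\cdots+x_{a+1}h_a)/b}$; $\mathrm{wal}_{\boldsymbol{h}}(\boldsymbol{x})=\prod_j\mathrm{wal}_{h_j}(x_j)$. Weighted Walsh space: $\mathcal{H}(K^{\mathrm{wal}}_{s,\alpha,\boldsymbol{\gamma}})$ is the reproducing kernel Hilbert space with kernel $$K^{\mathrm{wal}}_{s,\alpha,\boldsymbol{\gamma}}(\boldsymbol{x},\boldsymbol{y})=1+\sum_{\emptyset\ne\mathfrak{u}\subseteq[s]}\gamma_{\mathfrak{u}}\sum_{\boldsymbol{h}_{\mathfrak{u}}\in\mathbb{N}^{|\mathfrak{u}|}}r_\alpha(\boldsymbol{h}_{\mathfrak{u}})\,\mathrm{wal}_{\boldsymbol{h}_{\mathfrak{u}}}(\boldsymbol{x}_{\mathfrak{u}})\,\overline{\mathrm{wal}_{\boldsymbol{h}_{\mathfrak{u}}}(\boldsymbol{y}_{\mathfrak{u}})}.$$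 Polynomial lattice rule with modulus $x^m$: for $v\in\mathbb{F}_b[x]$ with $v\equiv a_0+a_1x+\cdots+a_{m-1}x^{m-1}\pmod{x^m}$ put $\nu(v/x^m)=\frac{a_{m-1}}{b}+\cdots+\frac{a_1}{b^{m-1}}+\frac{a_0}{b^m}\in[0,1)$. For $\boldsymbol{g}=(g_1,\ldots,g_s)\in(\mathbb{F}_b[x])^s$ the node set consists of the $b^m$ points $\boldsymbol{x}_n=(\nu(ng_1/x^m),\ldots,\nu(ng_s/x^m))$, $n\in\mathbb{F}_b[x]$, $\deg(n)<m$. Worst-case error: $e_{N,s}(\boldsymbol{g})$ is the supremum of the absolute integration error $\left|\int_{[0,1]^s}f-\frac1{b^m}\sum_nf(\boldsymbol{x}_n)\right|$ over the unit ball of $\mathcal{H}(K^{\mathrm{wal}}_{s,\alpha,\boldsymbol{\gamma}})$. It is known that $$e_{N,s}^2(\boldsymbol{g})=\sum_{\emptyset\ne\mathfrak{u}\subseteq[s]}\gamma_{\mathfrak{u}}\sum_{\boldsymbol{h}_{\mathfrak{u}}\in\mathcal{D}_{\mathfrak{u}}}\prod_{j\in\mathfrak{u}}b^{-\alpha\psi_b(h_j)},\qquad \mathcal{D}_{\mathfrak{u}}=\Big\{\boldsymbol{h}_{\mathfrak{u}}\in\mathbb{N}^{|\mathfrak{u}|}:\sum_{j\in\mathfrak{u}}\mathrm{tr}_m(h_j)g_j\equiv0\ (\mathrm{mod}\ x^m)\Big\},$$ where $\mathrm{tr}_m(h)=h_0+h_1x+\cdots+h_{m-1}x^{m-1}\in\mathbb{F}_b[x]$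 for $h=\sum_ih_ib^i$. Search spaces: $\mathcal{G}_{N,w_j}=\{g\in\mathbb{F}_b[x]:0\le\deg(g)<m-w_j,\ \gcd(g,x^m)=1\}$ if $w_j<m$, and $\mathcal{G}_{N,w_j}=\{1\}$ if $w_j\ge m$. Reduced SCS algorithm: given $\boldsymbol{g}^0=(g_1^0,\ldots,g_s^0)$, for $d=1,\ldots,s$ successively, with $g_1,\ldots,g_{d-1}$ already selected, choose $g_d\in\mathcal{G}_{N,w_d}$ such that $e_{N,s}^2((Y_1g_1,\ldots,Y_{d-1}g_{d-1},Y_dg_d,g_{d+1}^0,\ldots,g_s^0))$ is minimized as a function of $g_d$ over $\mathcal{G}_{N,w_d}$. The output is $\boldsymbol{g}=(Y_1g_1,\ldots,Y_sg_s)$. *)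

theory Defs
  imports "HOL-Analysis.Analysis" "Berlekamp_Zassenhaus.Finite_Field"
begin

section \<open>Reproducing kernel Hilbert spaces\<close>

text \<open>
  A complex Hilbert space \<open>H\<close> (with inner product \<open>ip\<close>, linear in the first argument) of functions
  on a set \<open>X\<close> with reproducing kernel \<open>K\<close>. Functions on \<open>X\<close> are represented by total functions
  vanishing outside \<open>X\<close>, so that a function on \<open>X\<close> has exactly one representative.
  For given \<open>X\<close> and \<open>K\<close> the set \<open>H\<close> and the values of \<open>ip\<close> on \<open>H\<close> are determined by these axioms.
\<close>

definition ip_norm :: "(('a \<Rightarrow> complex) \<Rightarrow> ('a \<Rightarrow> complex) \<Rightarrow> complex) \<Rightarrow> ('a \<Rightarrow> complex) \<Rightarrow> real" where
  "ip_norm ip f = sqrt (Re (ip f f))"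

definition kernel_section :: "'a set \<Rightarrow> ('a \<Rightarrow> 'a \<Rightarrow> complex) \<Rightarrow> 'a \<Rightarrow> 'a \<Rightarrow> complex" where
  "kernel_section X K y = (\<lambda>x. if x \<in> X then K x y else 0)"

locale rkhs =
  fixes X :: "'a set"
    and K :: "'a \<Rightarrow> 'a \<Rightarrow> complex"
    and H :: "('a \<Rightarrow> complex) set"
    and ip :: "('a \<Rightarrow> complex) \<Rightarrow> ('a \<Rightarrow> complex) \<Rightarrow> complex"
  assumes vanish_outside: "\<And>f x. f \<in> H \<Longrightarrow> x \<notin> X \<Longrightarrow> f x = 0"
    and zero_mem: "(\<lambda>_. 0) \<in> H"
    and add_mem: "\<And>f g. f \<in> H \<Longrightarrow> g \<in> H \<Longrightarrow> (\<lambda>x. f x + g x) \<in> H"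
    and scale_mem: "\<And>c f. f \<in> H \<Longrightarrow> (\<lambda>x. c * f x) \<in> H"
    and ip_add: "\<And>f g h. f \<in> H \<Longrightarrow> g \<in> H \<Longrightarrow> h \<in> H \<Longrightarrow> ip (\<lambda>x. f x + g x) h = ip f h + ip g h"
    and ip_scale: "\<And>c f g. f \<in> H \<Longrightarrow> g \<in> H \<Longrightarrow> ip (\<lambda>x. c * f x) g = c * ip f g"
    and ip_commute: "\<And>f g. f \<in> H \<Longrightarrow> g \<in> H \<Longrightarrow> ip g f = cnj (ip f g)"
    and ip_pos: "\<And>f. f \<in> H \<Longrightarrow> f \<noteq> (\<lambda>_. 0) \<Longrightarrow> 0 < Re (ip f f)"
    and complete: "\<And>F. (\<And>n::nat. F n \<in> H) \<Longrightarrow>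
        (\<And>e. e > 0 \<Longrightarrow> \<exists>M. \<forall>m\<ge>M. \<forall>n\<ge>M. ip_norm ip (\<lambda>x. F m x - F n x) < e) \<Longrightarrow>
        \<exists>f\<in>H. (\<lambda>n. ip_norm ip (\<lambda>x. F n x - f x)) \<longlonglongrightarrow> 0"
    and section_mem: "\<And>y. y \<in> X \<Longrightarrow> kernel_section X K y \<in> H"
    and reproducing: "\<And>f y. f \<in> H \<Longrightarrow> y \<in> X \<Longrightarrow> ip f (kernel_section X K y) = f y"


section \<open>Walsh functions and the weighted Walsh kernel\<close>

definition psi :: "nat \<Rightarrow> nat \<Rightarrow> int" where
  "psi b h = \<lfloor>log (real b) (real h)\<rfloor>"

definition walsh_weight :: "nat \<Rightarrow> real \<Rightarrow> nat \<Rightarrow> real" where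
  "walsh_weight b \<alpha> h = real b powr (- \<alpha> * of_int (psi b h))"

definition mu :: "nat \<Rightarrow> real \<Rightarrow> real" where
  "mu b \<beta> = (\<Sum>\<^sub>\<infinity>h\<in>{1..}. walsh_weight b \<beta> h)"

definition nat_digit :: "nat \<Rightarrow> nat \<Rightarrow> nat \<Rightarrow> nat" where
  "nat_digit b h i = (h div b ^ i) mod b"

text \<open>
  The coefficient of \<open>b\<close> to the power \<open>-i\<close> (\<open>i \<ge> 1\<close>) in the base-\<open>b\<close> expansion of \<open>x \<in> [0,1)\<close>;
  the floor selects the expansion with infinitely many digits different from \<open>b - 1\<close>.
\<close>
definition frac_digit :: "nat \<Rightarrow> real \<Rightarrow> nat \<Rightarrow> int" where
  "frac_digit b x i = \<lfloor>x * real b ^ i\<rfloor> mod int b"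

text \<open>For \<open>h = 0\<close> we have \<open>psi b 0 = 0\<close> since \<open>log b 0 = 0\<close>, hence \<open>wal b 0 x = 1\<close>.\<close>
definition wal :: "nat \<Rightarrow> nat \<Rightarrow> real \<Rightarrow> complex" where
  "wal b h x = exp (2 * of_real pi * \<i> *
     of_int (\<Sum>i\<le>nat (psi b h). frac_digit b x (Suc i) * int (nat_digit b h i)) / of_nat b)"

definition unit_cube :: "nat \<Rightarrow> (nat \<Rightarrow> real) set" where
  "unit_cube s = (\<Pi>\<^sub>E j\<in>{1..s}. {0..<1})"

definition walsh_kernel ::
  "nat \<Rightarrow> real \<Rightarrow> (nat set \<Rightarrow> real) \<Rightarrow> nat \<Rightarrow> (nat \<Rightarrow> real) \<Rightarrow> (nat \<Rightarrow> real) \<Rightarrow> complex" where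
  "walsh_kernel b \<alpha> \<gamma> s x y =
     1 + (\<Sum>u\<in>{u. u \<noteq> {} \<and> u \<subseteq> {1..s}}. of_real (\<gamma> u) *
       (\<Sum>\<^sub>\<infinity>h\<in>(\<Pi>\<^sub>E j\<in>u. {1..}). of_real (\<Prod>j\<in>u. walsh_weight b \<alpha> (h j)) *
          (\<Prod>j\<in>u. wal b (h j) (x j)) * cnj (\<Prod>j\<in>u. wal b (h j) (y j))))"


section \<open>Polynomial lattice rules with modulus \<open>x^m\<close>\<close>

text \<open>
  The finite field with prime cardinality \<open>b = CARD('b)\<close> is \<open>'b mod_ring\<close>;
  \<open>to_int_mod_ring\<close> is its identification with \<open>{0..b-1}\<close>.
\<close>

definition nu :: "nat \<Rightarrow> 'b::prime_card mod_ring poly \<Rightarrow> real" where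
  "nu m v = (\<Sum>i<m. of_int (to_int_mod_ring (poly.coeff (v mod Polynomial.monom 1 m) i)) / real CARD('b) ^ (m - i))"

definition lattice_point ::
  "nat \<Rightarrow> nat \<Rightarrow> (nat \<Rightarrow> 'b::prime_card mod_ring poly) \<Rightarrow> 'b mod_ring poly \<Rightarrow> nat \<Rightarrow> real" where
  "lattice_point s m g n = (\<lambda>j\<in>{1..s}. nu m (n * g j))"

text \<open>For \<open>m \<ge> 1\<close>, \<open>degree n < m\<close> includes \<open>n = 0\<close>, as \<open>degree 0 = 0\<close>.\<close>
definition lattice_rule ::
  "nat \<Rightarrow> nat \<Rightarrow> (nat \<Rightarrow> 'b::prime_card mod_ring poly) \<Rightarrow> ((nat \<Rightarrow> real) \<Rightarrow> complex) \<Rightarrow> complex" where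
  "lattice_rule s m g f =
     (\<Sum>n | degree n < m. f (lattice_point s m g n)) / of_nat (CARD('b) ^ m)"

definition integration_error ::
  "nat \<Rightarrow> nat \<Rightarrow> (nat \<Rightarrow> 'b::prime_card mod_ring poly) \<Rightarrow> ((nat \<Rightarrow> real) \<Rightarrow> complex) \<Rightarrow> real" where
  "integration_error s m g f =
     cmod ((LINT x:unit_cube s|(\<Pi>\<^sub>M j\<in>{1..s}. lborel). f x) - lattice_rule s m g f)"

definition worst_case_error ::
  "((nat \<Rightarrow> real) \<Rightarrow> complex) set \<Rightarrow>
   (((nat \<Rightarrow> real) \<Rightarrow> complex) \<Rightarrow> ((nat \<Rightarrow> real) \<Rightarrow> complex) \<Rightarrow> complex) \<Rightarrow>
   nat \<Rightarrow> nat \<Rightarrow> (nat \<Rightarrow> 'b::prime_card mod_ring poly) \<Rightarrow> real" where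
  "worst_case_error H ip s m g = (SUP f\<in>{f \<in> H. ip_norm ip f \<le> 1}. integration_error s m g f)"


section \<open>The reduced successive coordinate search algorithm\<close>

definition search_space :: "nat \<Rightarrow> nat \<Rightarrow> 'b::prime_card mod_ring poly set" where
  "search_space m w =
     (if w < m then {g. g \<noteq> 0 \<and> degree g < m - w \<and> coprime g (Polynomial.monom 1 m)} else {1})"

definition Y_pow :: "(nat \<Rightarrow> nat) \<Rightarrow> nat \<Rightarrow> 'b::prime_card mod_ring poly" where
  "Y_pow w j = Polynomial.monom 1 (w j)"

text \<open>
  \<open>scs_candidate w g0 g d q\<close> is the vector
  \<open>(Y_1 g_1, ..., Y_(d-1) g_(d-1), Y_d q, g0_(d+1), ..., g0_s)\<close>.
\<close>
definition scs_candidate ::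
  "(nat \<Rightarrow> nat) \<Rightarrow> (nat \<Rightarrow> 'b::prime_card mod_ring poly) \<Rightarrow> (nat \<Rightarrow> 'b mod_ring poly) \<Rightarrow>
   nat \<Rightarrow> 'b mod_ring poly \<Rightarrow> nat \<Rightarrow> 'b mod_ring poly" where
  "scs_candidate w g0 g d q j =
     (if j < d then Y_pow w j * g j else if j = d then Y_pow w d * q else g0 j)"

text \<open>
  \<open>g\<close> is a possible result of the algorithm minimizing \<open>E\<close> with starting vector \<open>g0\<close>:
  every \<open>g d\<close> is a minimizer, ties being broken arbitrarily.
\<close>
definition reduced_scs ::
  "((nat \<Rightarrow> 'b::prime_card mod_ring poly) \<Rightarrow> real) \<Rightarrow> nat \<Rightarrow> nat \<Rightarrow> (nat \<Rightarrow> nat) \<Rightarrow>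
   (nat \<Rightarrow> 'b mod_ring poly) \<Rightarrow> (nat \<Rightarrow> 'b mod_ring poly) \<Rightarrow> bool" where
  "reduced_scs E s m w g0 g \<longleftrightarrow>
     (\<forall>d\<in>{1..s}. is_arg_min (\<lambda>q. E (scs_candidate w g0 g d q)) (\<lambda>q. q \<in> search_space m (w d)) (g d))"

end

theory Submission
  imports Defs
begin

text \<open>
  The squared worst-case error equals the weighted sum over \<open>u\<close> of the Walsh weights of the dual net.
  To see this without a density argument, approximate integrals by means over \<open>b\<close>-adic grids. The
  kernel sections at \<open>x\<close> and at its \<open>M\<close>-digit truncation differ in norm by a tail of the kernel
  series, so every function of the space is a uniform limit of step functions; and the grid means of
  the kernel sections form a Cauchy sequence with limit the constant 1, which represents the integral.

  In step \<open>d\<close> of the algorithm only the sets \<open>u\<close> containing \<open>d\<close> matter. For fixed frequencies in the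
  other coordinates, the congruence modulo \<open>x^m\<close> forces the multiplicity \<open>t\<close> of \<open>x\<close> in the truncation of
  the \<open>d\<close>-th frequency; there are then at most \<open>b^t\<close> admissible \<open>q\<close>, while the frequencies divisible
  by \<open>b^t\<close> have total weight at most \<open>mu / b^t\<close>. Averaging the \<open>lam\<close>-th powers gives the bound for
  step \<open>d\<close>. Finally each \<open>u\<close> is charged to its maximal element \<open>d\<close>: after step \<open>d\<close> the
  components in \<open>u\<close> no longer change.
\<close>

section \<open>Sums of Walsh weights\<close>

text \<open>The space is known only through the Hilbert space axioms and its kernel, so at the start
  neither measurability of its elements nor membership of the constant 1 is available; both come out
  of truncating the kernel. Truncation also serves the estimates: sums run over finite boxes of
  frequencies below \<open>b ^ L\<close>, where exchanging sums and taking powers is elementary, and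
  L tends to infinity afterwards. Powers of b are the natural cut-off, since a frequency below
  \<open>b ^ M\<close> sees at most the first M digits of a point. The factor 2 comes from the size
  of the search space, (b - 1) b^(m-w-1) instead of b^(m-w), together with b <= 2 (b - 1). In step d
  the sets u reaching beyond d still involve components of \<open>g0\<close>. This is harmless
  because the average over q is bounded uniformly in all other components. The two bounds on
  \<open>lam\<close> have separate purposes: 1/\<alpha> < \<open>lam\<close> makes the series for mu
  at \<alpha> \<open>lam\<close> converge, while \<open>lam\<close> <= 1 makes the power
  \<open>lam\<close> subadditive and the power 1/\<open>lam\<close> superadditive.\<close>

text \<open>After division by x + y both fractions lie in [0,1], where z is at most its p-th power
  because p <= 1.\<close>

lemma powr_add_le_add_powr:
  fixes x y p :: real
  assumes "0 \<le> x" "0 \<le> y" "0 < p" "p \<le> 1"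
  shows "(x + y) powr p \<le> x powr p + y powr p"
proof (cases "x + y = 0")
  case True
  then show ?thesis using assms by auto
next
  case False
  with assms have s: "x + y > 0" by linarith
  have aux: "z / (x + y) \<le> (z / (x + y)) powr p" if "0 \<le> z" "z \<le> x + y" for z
  proof (cases "z = 0")
    case False
    then have "0 < z / (x + y)" "z / (x + y) \<le> 1" using that s by auto
    then have "(z / (x + y)) powr 1 \<le> (z / (x + y)) powr p"
      using assms by (intro powr_mono') auto
    then show ?thesis using \<open>0 < z / (x + y)\<close> by (simp only: powr_one)
  qed auto
  have "1 = x / (x + y) + y / (x + y)" using s by (simp add: add_divide_distrib[symmetric])
  also have "\<dots> \<le> (x / (x + y)) powr p + (y / (x + y)) powr p"
    using assms by (intro add_mono aux) auto
  also have "\<dots> = (x powr p + y powr p) / (x + y) powr p"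
    using assms s by (simp add: powr_divide add_divide_distrib)
  finally show ?thesis using s by (simp add: field_simps)
qed

lemma powr_sum_le_sum_powr:
  fixes f :: "'a \<Rightarrow> real"
  assumes "finite A" "\<And>x. x \<in> A \<Longrightarrow> 0 \<le> f x" "0 < p" "p \<le> 1"
  shows "(\<Sum>x\<in>A. f x) powr p \<le> (\<Sum>x\<in>A. f x powr p)"
  using assms(1,2)
proof (induction A)
  case (insert a A)
  have "(f a + sum f A) powr p \<le> f a powr p + sum f A powr p"
    using insert.prems assms by (intro powr_add_le_add_powr) (auto intro: sum_nonneg)
  also have "\<dots> \<le> f a powr p + (\<Sum>x\<in>A. f x powr p)"
    using insert by auto
  finally show ?case using insert by simp
qed auto

text \<open>Subadditivity of the p-th power, applied to the numbers \<open>f x powr (1 / p)\<close>.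
  It merges the bounds of the single search steps at the very end.\<close>

lemma sum_powr_le_powr_sum:
  fixes f :: "'a \<Rightarrow> real"
  assumes "finite A" "\<And>x. x \<in> A \<Longrightarrow> 0 \<le> f x" "0 < p" "p \<le> 1"
  shows "(\<Sum>x\<in>A. f x powr (1 / p)) \<le> (\<Sum>x\<in>A. f x) powr (1 / p)"
proof -
  have "(\<Sum>x\<in>A. f x powr (1 / p)) = ((\<Sum>x\<in>A. f x powr (1 / p)) powr p) powr (1 / p)"
    using assms by (simp add: powr_powr sum_nonneg)
  also have "\<dots> \<le> (\<Sum>x\<in>A. (f x powr (1 / p)) powr p) powr (1 / p)"
    using assms by (intro powr_mono2 powr_sum_le_sum_powr) auto
  also have "(\<Sum>x\<in>A. (f x powr (1 / p)) powr p) = (\<Sum>x\<in>A. f x)"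
    using assms by (intro sum.cong) (auto simp: powr_powr)
  finally show ?thesis .
qed

section \<open>Walsh weights and their sums in one coordinate\<close>

lemma walsh_weight_nonneg [simp]: "0 \<le> walsh_weight b \<beta> h"
  by (simp add: walsh_weight_def)

lemma prod_walsh_weight_nonneg [simp]: "0 \<le> (\<Prod>j\<in>u. walsh_weight b \<beta> (h j))"
  by (simp add: prod_nonneg)

lemma walsh_weight_powr: "walsh_weight b \<alpha> h powr p = walsh_weight b (\<alpha> * p) h"
  by (simp add: walsh_weight_def powr_powr mult_ac)

lemma psi_power_mult:
  assumes "b \<ge> 2" "h \<ge> 1"
  shows "psi b (b ^ t * h) = int t + psi b h"
proof -
  have "log (real b) (real (b ^ t * h)) = of_int (int t) + log (real b) (real h)"
    using assms by (simp add: log_mult log_nat_power)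
  then show ?thesis unfolding psi_def by linarith
qed

lemma walsh_weight_power_mult:
  assumes "b \<ge> 2" "h \<ge> 1"
  shows "walsh_weight b \<beta> (b ^ t * h) = real b powr (- \<beta> * real t) * walsh_weight b \<beta> h"
  using assms unfolding walsh_weight_def psi_power_mult[OF assms]
  by (simp add: powr_add[symmetric] algebra_simps)

text \<open>The floor in \<open>psi\<close> lowers the logarithm by at most 1, which costs the
  constant \<open>b powr\<close> \<beta>. Comparison with the zeta series then gives summability for
  \<beta> > 1.\<close>

lemma walsh_weight_le_powr:
  assumes "b \<ge> 2" "h \<ge> 1" "\<beta> \<ge> 0"
  shows "walsh_weight b \<beta> h \<le> real b powr \<beta> * real h powr (- \<beta>)"
proof -
  have "log (real b) (real h) - 1 \<le> of_int (psi b h)"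
    unfolding psi_def by linarith
  then have "\<beta> * (log (real b) (real h) - 1) \<le> \<beta> * of_int (psi b h)"
    using assms by (intro mult_left_mono)
  then have "walsh_weight b \<beta> h \<le> real b powr (\<beta> + log (real b) (real h) * (- \<beta>))"
    using assms unfolding walsh_weight_def by (intro powr_mono) (auto simp: algebra_simps)
  also have "\<dots> = real b powr \<beta> * (real b powr log (real b) (real h)) powr (- \<beta>)"
    unfolding powr_add powr_powr by simp
  finally show ?thesis using assms by simp
qed

lemma walsh_weight_summable:
  assumes "b \<ge> 2" "\<beta> > 1"
  shows "walsh_weight b \<beta> summable_on {1..}"
proof -
  have "summable (\<lambda>h. real b powr \<beta> * real h powr (- \<beta>))"
    using assms by (intro summable_mult) (simp add: summable_real_powr_iff)
  then have "(\<lambda>h. real b powr \<beta> * real h powr (- \<beta>)) summable_on {1..}"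
    by (intro summable_on_subset[OF norm_summable_imp_summable_on, of _ "{1..}"]) auto
  then show ?thesis
    by (rule summable_on_comparison_test) (use assms walsh_weight_le_powr in auto)
qed

lemma sum_walsh_weight_le_mu:
  assumes "b \<ge> 2" "\<beta> > 1" "finite A" "A \<subseteq> {1..}"
  shows "(\<Sum>h\<in>A. walsh_weight b \<beta> h) \<le> mu b \<beta>"
  unfolding mu_def using assms
  by (intro finite_sum_le_infsum walsh_weight_summable) auto

lemma mu_nonneg: "0 \<le> mu b \<beta>"
  unfolding mu_def by (rule infsum_nonneg) simp

text \<open>Writing h = b^t k scales each weight by b^(-\<beta> t), and \<beta> > 1 allows replacing
  this by b^(-t). That weaker factor is exactly what compensates for b^t admissible polynomials q
  later on.\<close>

lemma sum_walsh_weight_multiples_le: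
  assumes "b \<ge> 2" "\<beta> > 1" "finite A" "A \<subseteq> {h. 1 \<le> h \<and> b ^ t dvd h}"
  shows "(\<Sum>h\<in>A. walsh_weight b \<beta> h) \<le> mu b \<beta> / real b ^ t"
proof -
  define A' where "A' = (\<lambda>h. h div b ^ t) ` A"
  have eq: "b ^ t * (h div b ^ t) = h" if "h \<in> A" for h
    using that assms by auto
  have inj: "inj_on (\<lambda>h. h div b ^ t) A"
    by (rule inj_on_inverseI[where g = "\<lambda>k. b ^ t * k"]) (rule eq)
  have sub: "A' \<subseteq> {1..}"
  proof
    fix k assume "k \<in> A'"
    then obtain h where h: "h \<in> A" "k = h div b ^ t" by (auto simp: A'_def)
    then have "b ^ t * k \<ge> 1" using eq assms by auto
    then show "k \<in> {1..}" by (cases k) auto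
  qed
  have "(\<Sum>h\<in>A. walsh_weight b \<beta> h) = (\<Sum>h\<in>A. walsh_weight b \<beta> (b ^ t * (h div b ^ t)))"
    by (intro sum.cong) (auto simp: eq)
  also have "\<dots> = (\<Sum>k\<in>A'. walsh_weight b \<beta> (b ^ t * k))"
    unfolding A'_def using inj by (simp add: sum.reindex)
  also have "\<dots> = (\<Sum>k\<in>A'. real b powr (- \<beta> * real t) * walsh_weight b \<beta> k)"
    using sub assms by (intro sum.cong) (auto simp: walsh_weight_power_mult)
  also have "\<dots> = real b powr (- \<beta> * real t) * (\<Sum>k\<in>A'. walsh_weight b \<beta> k)"
    by (simp add: sum_distrib_left)
  also have "\<dots> \<le> real b powr (- real t) * mu b \<beta>"
  proof (intro mult_mono sum_walsh_weight_le_mu)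
    have "1 * real t \<le> \<beta> * real t" using assms by (intro mult_right_mono) auto
    then show "real b powr (- \<beta> * real t) \<le> real b powr (- real t)"
      using assms by (intro powr_mono) auto
  qed (use assms sub in \<open>auto simp: A'_def intro: sum_nonneg\<close>)
  also have "\<dots> = mu b \<beta> / real b ^ t"
    using assms by (simp add: powr_minus_divide powr_realpow)
  finally show ?thesis .
qed

section \<open>Finite boxes of frequencies\<close>

text \<open>The side is a power of b so that on the grid of level L all Walsh functions in the box
  are orthogonal to the constants and depend on L digits only.\<close>

definition freq_box :: "nat \<Rightarrow> nat set \<Rightarrow> nat \<Rightarrow> (nat \<Rightarrow> nat) set" where
  "freq_box b u L = (\<Pi>\<^sub>E j\<in>u. {1..<b ^ L})"

lemma finite_freq_box [simp]: "finite u \<Longrightarrow> finite (freq_box b u L)"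
  by (simp add: freq_box_def finite_PiE)

lemma freq_box_subset: "freq_box b u L \<subseteq> (\<Pi>\<^sub>E j\<in>u. {1..})"
  unfolding freq_box_def by (intro PiE_mono) auto

lemma freq_box_mono: "b \<ge> 2 \<Longrightarrow> L \<le> M \<Longrightarrow> freq_box b u L \<subseteq> freq_box b u M"
  unfolding freq_box_def
  by (intro PiE_mono) (auto intro: order.strict_trans2 power_increasing)

lemma finite_subset_freq_box:
  assumes "b \<ge> 2" "finite u" "finite F" "F \<subseteq> (\<Pi>\<^sub>E j\<in>u. {1..})"
  obtains L where "F \<subseteq> freq_box b u L"
proof -
  \<comment> \<open>The largest component occurring in F serves as exponent, because L < 2^L <=
    b^L.\<close>
  define L where "L = Max (insert 0 (case_prod (\<lambda>h j. h j) ` (F \<times> u)))"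
  have "F \<subseteq> freq_box b u L"
  proof
    fix h assume h: "h \<in> F"
    have "h j < b ^ L" if "j \<in> u" for j
    proof -
      have "h j \<le> L" unfolding L_def using assms h that by (intro Max_ge) auto
      also have "L < 2 ^ L" by simp
      also have "\<dots> \<le> b ^ L" using assms by (intro power_mono) auto
      finally show ?thesis .
    qed
    then show "h \<in> freq_box b u L"
      using h subsetD[OF assms(4) h] unfolding freq_box_def by (simp add: PiE_iff)
  qed
  then show thesis by (rule that)
qed

text \<open>The boxes increase and are cofinal among the finite sets of frequencies, so the
  unordered sum is an ordinary limit along L.\<close>

lemma freq_box_sum_tendsto:
  fixes f :: "(nat \<Rightarrow> nat) \<Rightarrow> 'a::{comm_monoid_add, t2_space}"
  assumes "b \<ge> 2" "finite u" "A \<subseteq> (\<Pi>\<^sub>E j\<in>u. {1..})" "f summable_on A"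
  shows "(\<lambda>L. \<Sum>h\<in>freq_box b u L \<inter> A. f h) \<longlonglongrightarrow> infsum f A"
proof -
  have "filterlim (\<lambda>L. freq_box b u L \<inter> A) (finite_subsets_at_top A) sequentially"
    unfolding filterlim_finite_subsets_at_top
  proof (intro allI impI)
    fix F assume F: "finite F \<and> F \<subseteq> A"
    then obtain L where L: "F \<subseteq> freq_box b u L"
      using finite_subset_freq_box[OF assms(1,2), of F] assms(3) by auto
    show "\<forall>\<^sub>F M in sequentially. finite (freq_box b u M \<inter> A) \<and> F \<subseteq> freq_box b u M \<inter> A \<and> freq_box b u M \<inter> A \<subseteq> A"
      using eventually_ge_at_top[of L]
    proof eventually_elim
      case (elim M)
      then show ?case using freq_box_mono[OF assms(1), of L M u] L F assms(2) by auto
    qed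
  qed
  then show ?thesis
    using infsum_tendsto[OF assms(4)] by (rule filterlim_compose[rotated])
qed

text \<open>F fits into a box, and over a box the sum of products factors into one-dimensional
  sums.\<close>

lemma sum_prod_walsh_weight_le:
  fixes u :: "nat set"
  assumes "b \<ge> 2" "\<beta> > 1" "finite u" "finite F" "F \<subseteq> (\<Pi>\<^sub>E j\<in>u. {1..})"
  shows "(\<Sum>h\<in>F. \<Prod>j\<in>u. walsh_weight b \<beta> (h j)) \<le> mu b \<beta> ^ card u"
proof -
  obtain L where L: "F \<subseteq> freq_box b u L"
    using finite_subset_freq_box assms by metis
  have "(\<Sum>h\<in>F. \<Prod>j\<in>u. walsh_weight b \<beta> (h j)) \<le> (\<Sum>h\<in>freq_box b u L. \<Prod>j\<in>u. walsh_weight b \<beta> (h j))"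
    using assms L by (intro sum_mono2) (auto intro: prod_nonneg)
  also have "\<dots> = (\<Prod>j\<in>u. \<Sum>h\<in>{1..<b ^ L}. walsh_weight b \<beta> h)"
    unfolding freq_box_def using assms by (subst prod_sum_PiE) auto
  also have "\<dots> \<le> (\<Prod>j\<in>u. mu b \<beta>)"
    using assms by (intro prod_mono) (auto intro!: sum_nonneg sum_walsh_weight_le_mu)
  finally show ?thesis by simp
qed

lemma prod_walsh_weight_summable:
  fixes u :: "nat set"
  assumes "b \<ge> 2" "\<beta> > 1" "finite u" "A \<subseteq> (\<Pi>\<^sub>E j\<in>u. {1..})"
  shows "(\<lambda>h. \<Prod>j\<in>u. walsh_weight b \<beta> (h j)) summable_on A"
proof (rule nonneg_bdd_above_summable_on)
  show "bdd_above (sum (\<lambda>h. \<Prod>j\<in>u. walsh_weight b \<beta> (h j)) ` {F. F \<subseteq> A \<and> finite F})"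
    using sum_prod_walsh_weight_le[OF assms(1-3)] assms(4)
    by (intro bdd_aboveI[of _ "mu b \<beta> ^ card u"]) auto
qed (auto intro: prod_nonneg)

section \<open>Quadrature in reproducing kernel Hilbert spaces\<close>

lemma mean_dist_le:
  fixes f :: "'a \<Rightarrow> complex"
  assumes "finite P" "P \<noteq> {}" "\<And>y. y \<in> P \<Longrightarrow> cmod (f y - c) \<le> d"
  shows "cmod ((\<Sum>y\<in>P. f y) / of_nat (card P) - c) \<le> d"
proof -
  have card: "card P > 0" using assms by (simp add: card_gt_0_iff)
  have "(\<Sum>y\<in>P. f y) / of_nat (card P) - c = (\<Sum>y\<in>P. f y - c) / of_nat (card P)"
    using card by (simp add: sum_subtractf diff_divide_distrib)
  also have "cmod \<dots> \<le> (\<Sum>y\<in>P. d) / real (card P)"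
    unfolding norm_divide norm_of_nat
    by (intro divide_right_mono order.trans[OF norm_sum] sum_mono assms) auto
  finally show ?thesis using card by simp
qed

section \<open>Representers of point evaluations, means and the integral\<close>

context rkhs
begin

lemma diff_mem: "f \<in> H \<Longrightarrow> g \<in> H \<Longrightarrow> (\<lambda>x. f x - g x) \<in> H"
  using add_mem[OF _ scale_mem[of g "-1"]] by auto

lemma sum_mem:
  "finite I \<Longrightarrow> (\<And>i. i \<in> I \<Longrightarrow> F i \<in> H) \<Longrightarrow> (\<lambda>x. \<Sum>i\<in>I. F i x) \<in> H"
  by (induction I rule: finite_induct) (auto intro: zero_mem add_mem)

lemma ip_zero_left: "g \<in> H \<Longrightarrow> ip (\<lambda>_. 0) g = 0"
  using ip_scale[OF zero_mem, of g 0] by simp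

lemma ip_sum_left:
  "finite I \<Longrightarrow> (\<And>i. i \<in> I \<Longrightarrow> F i \<in> H) \<Longrightarrow> g \<in> H \<Longrightarrow>
    ip (\<lambda>x. \<Sum>i\<in>I. F i x) g = (\<Sum>i\<in>I. ip (F i) g)"
  by (induction I rule: finite_induct) (auto simp: ip_zero_left ip_add sum_mem)

lemma ip_diff_left:
  assumes "f \<in> H" "g \<in> H" "h \<in> H"
  shows "ip (\<lambda>x. f x - g x) h = ip f h - ip g h"
  using ip_add[OF assms(1) scale_mem[OF assms(2), of "-1"] assms(3)]
    ip_scale[OF assms(2,3), of "-1"] by simp

lemma ip_diff_right:
  assumes "f \<in> H" "g \<in> H" "h \<in> H"
  shows "ip h (\<lambda>x. f x - g x) = ip h f - ip h g"
  using ip_commute[OF diff_mem[OF assms(1,2)] assms(3)] ip_commute[OF assms(1,3)]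
    ip_commute[OF assms(2,3)] ip_diff_left[OF assms] by simp

lemma ip_scale_right: "f \<in> H \<Longrightarrow> g \<in> H \<Longrightarrow> ip f (\<lambda>x. c * g x) = cnj c * ip f g"
  using ip_commute[OF scale_mem[of g c], of f] ip_commute[of g f] ip_scale[of g f c] by simp

lemma ip_self_nonneg: "f \<in> H \<Longrightarrow> 0 \<le> Re (ip f f)"
  using ip_pos[of f] ip_zero_left[OF zero_mem] by (cases "f = (\<lambda>_. 0)") auto

lemma ip_norm_nonneg: "f \<in> H \<Longrightarrow> 0 \<le> ip_norm ip f"
  unfolding ip_norm_def by (simp add: ip_self_nonneg)

lemma ip_norm_sq: "f \<in> H \<Longrightarrow> (ip_norm ip f)\<^sup>2 = Re (ip f f)"
  by (simp add: ip_norm_def ip_self_nonneg)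

lemma ip_self: "f \<in> H \<Longrightarrow> ip f f = of_real ((ip_norm ip f)\<^sup>2)"
  using ip_commute[of f f] by (simp add: complex_eq_iff ip_norm_sq)

lemma ip_norm_diff_sq:
  assumes "f \<in> H" "g \<in> H"
  shows "(ip_norm ip (\<lambda>x. f x - g x))\<^sup>2 = Re (ip f f - ip f g - ip g f + ip g g)"
  using assms by (simp add: ip_norm_sq diff_mem ip_diff_left ip_diff_right)

lemma cauchy_schwarz:
  assumes f: "f \<in> H" and g: "g \<in> H"
  shows "cmod (ip f g) \<le> ip_norm ip f * ip_norm ip g"
proof (cases "g = (\<lambda>_. 0)")
  case True
  then have "ip f g = 0" using ip_commute[OF zero_mem f] ip_zero_left[OF f] by simp
  then show ?thesis using f g by (simp add: ip_norm_nonneg)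
next
  case False
  define n where "n = (ip_norm ip g)\<^sup>2"
  have n: "n > 0" using ip_pos[OF g False] ip_norm_sq[OF g] by (simp add: n_def)
  \<comment> \<open>The coefficient of the orthogonal projection of f onto g; the remainder f - c g
    is then orthogonal to g, and its squared norm is nonnegative.\<close>
  define c where "c = ip f g / of_real n"
  have cg: "(\<lambda>x. c * g x) \<in> H" using g by (rule scale_mem)
  have orth: "ip g (\<lambda>x. f x - c * g x) = 0"
    unfolding ip_diff_right[OF f cg g] ip_scale_right[OF g g]
    using n ip_self[OF g] ip_commute[OF f g] by (simp add: c_def n_def[symmetric])
  have "ip (\<lambda>x. f x - c * g x) (\<lambda>x. f x - c * g x) = ip f (\<lambda>x. f x - c * g x)"
    using orth by (simp add: ip_diff_left f cg diff_mem ip_scale g)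
  also have "\<dots> = of_real ((ip_norm ip f)\<^sup>2) - of_real ((cmod (ip f g))\<^sup>2 / n)"
    unfolding ip_diff_right[OF f cg f] ip_scale_right[OF f g] ip_self[OF f]
    by (simp add: c_def complex_norm_square mult.commute del: of_real_power)
  finally have "0 \<le> (ip_norm ip f)\<^sup>2 - (cmod (ip f g))\<^sup>2 / n"
    using ip_self_nonneg[OF diff_mem[OF f cg]] by (simp flip: of_real_diff)
  then have "(cmod (ip f g))\<^sup>2 \<le> (ip_norm ip f)\<^sup>2 * n"
    using n by (simp add: field_simps)
  then have "(cmod (ip f g))\<^sup>2 \<le> (ip_norm ip f * ip_norm ip g)\<^sup>2"
    by (simp add: n_def power_mult_distrib)
  then show ?thesis
    by (rule power2_le_imp_le) (simp add: f g ip_norm_nonneg)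
qed

lemma ip_kernel_sections:
  "x \<in> X \<Longrightarrow> y \<in> X \<Longrightarrow> ip (kernel_section X K x) (kernel_section X K y) = K y x"
  by (simp add: reproducing section_mem) (simp add: kernel_section_def)

text \<open>The difference of two values is the inner product with the difference of two kernel
  sections. This converts closeness of kernel values into closeness of function values, uniformly on
  norm balls.\<close>

lemma dist_le_norm_mult_sqrt_kernel:
  assumes f: "f \<in> H" and x: "x \<in> X" and y: "y \<in> X"
  shows "cmod (f x - f y) \<le> ip_norm ip f * sqrt (Re (K x x - K x y - K y x + K y y))"
proof -
  note mem = section_mem[OF x] section_mem[OF y]
  have "f x - f y = ip f (\<lambda>z. kernel_section X K x z - kernel_section X K y z)"
    using mem f x y by (simp add: ip_diff_right reproducing)
  also have "cmod \<dots> \<le> ip_norm ip f * ip_norm ip (\<lambda>z. kernel_section X K x z - kernel_section X K y z)"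
    using mem by (intro cauchy_schwarz f diff_mem)
  also have "ip_norm ip (\<lambda>z. kernel_section X K x z - kernel_section X K y z) =
      sqrt (Re (K x x - K x y - K y x + K y y))"
    unfolding ip_norm_def using mem x y
    by (simp add: diff_mem ip_diff_left ip_diff_right ip_kernel_sections algebra_simps)
  finally show ?thesis .
qed

lemma norm_le_norm_mult_sqrt_kernel:
  assumes f: "f \<in> H" and x: "x \<in> X"
  shows "cmod (f x) \<le> ip_norm ip f * sqrt (Re (K x x))"
  using cauchy_schwarz[OF f section_mem[OF x]] reproducing[OF f x] ip_kernel_sections[OF x x]
  by (simp add: ip_norm_def)

text \<open>The representer of an equal-weight quadrature rule. P is an index set and p gives the
  nodes, so coinciding nodes are counted with multiplicity, as happens for polynomial lattice
  points.\<close>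

definition mean_section :: "'i set \<Rightarrow> ('i \<Rightarrow> 'a) \<Rightarrow> 'a \<Rightarrow> complex" where
  "mean_section P p = (\<lambda>x. (1 / of_nat (card P)) * (\<Sum>n\<in>P. kernel_section X K (p n) x))"

lemma mean_section_mem: "finite P \<Longrightarrow> p ` P \<subseteq> X \<Longrightarrow> mean_section P p \<in> H"
  unfolding mean_section_def by (intro scale_mem sum_mem section_mem) auto

lemma mean_section_apply:
  "x \<in> X \<Longrightarrow> mean_section P p x = (\<Sum>n\<in>P. K x (p n)) / of_nat (card P)"
  unfolding mean_section_def by (simp add: kernel_section_def)

lemma ip_mean_section:
  assumes f: "f \<in> H" and P: "finite P" "p ` P \<subseteq> X"
  shows "ip f (mean_section P p) = (\<Sum>n\<in>P. f (p n)) / of_nat (card P)"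
proof -
  have mem: "kernel_section X K (p n) \<in> H" if "n \<in> P" for n
    using that P by (intro section_mem) auto
  have "ip (mean_section P p) f = (1 / of_nat (card P)) * (\<Sum>n\<in>P. ip (kernel_section X K (p n)) f)"
    unfolding mean_section_def using f P mem by (simp add: ip_scale sum_mem ip_sum_left del: times_divide_eq_left)
  also have "(\<Sum>n\<in>P. ip (kernel_section X K (p n)) f) = (\<Sum>n\<in>P. cnj (f (p n)))"
  proof (intro sum.cong refl)
    fix n assume n: "n \<in> P"
    then have "p n \<in> X" using P by auto
    then show "ip (kernel_section X K (p n)) f = cnj (f (p n))"
      using ip_commute[OF f mem[OF n]] reproducing[OF f] by simp
  qed
  finally have "ip (mean_section P p) f = (\<Sum>n\<in>P. cnj (f (p n))) / of_nat (card P)" by simp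
  then show ?thesis
    using ip_commute[OF mean_section_mem[OF P] f] by simp
qed

text \<open>
  If the means of the kernel sections over the finite sets \<open>P M\<close> tend uniformly to 1, then these
  means form a Cauchy sequence, so the constant 1 belongs to the space and represents
  the limit of the quadrature rules.
\<close>
lemma mean_representer:
  fixes P :: "nat \<Rightarrow> 'a set"
  assumes P: "\<And>M. finite (P M)" "\<And>M. P M \<noteq> {}" "\<And>M. P M \<subseteq> X"
    and \<delta>: "\<delta> \<longlonglongrightarrow> 0"
    and bound: "\<And>M x. x \<in> X \<Longrightarrow> cmod ((\<Sum>y\<in>P M. K x y) / of_nat (card (P M)) - 1) \<le> \<delta> M"
  obtains R where "R \<in> H" "\<And>x. x \<in> X \<Longrightarrow> R x = 1" "ip R R = 1"
    "\<And>f. f \<in> H \<Longrightarrow> (\<lambda>M. (\<Sum>y\<in>P M. f y) / of_nat (card (P M))) \<longlonglongrightarrow> ip f R"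
proof -
  define Q where "Q M = mean_section (P M) (\<lambda>y. y)" for M
  have Q: "Q M \<in> H" for M
    unfolding Q_def using P by (intro mean_section_mem) auto
  have ipQ: "ip f (Q M) = (\<Sum>y\<in>P M. f y) / of_nat (card (P M))" if "f \<in> H" for f M
    unfolding Q_def using P that by (subst ip_mean_section) auto
  have Q1: "cmod (Q M x - 1) \<le> \<delta> M" if "x \<in> X" for M x
    using bound[OF that, of M] unfolding Q_def by (simp add: mean_section_apply that)
  \<comment> \<open>The inner product is the mean of \<open>Q M\<close> over the N-th point set, and
    \<open>Q M\<close> is uniformly close to 1; hence the bound does not depend on N.\<close>
  have QQ: "cmod (ip (Q M) (Q N) - 1) \<le> \<delta> M" for M N
    unfolding ipQ[OF Q] by (intro mean_dist_le P Q1 subsetD[OF P(3)])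
  have diff: "(ip_norm ip (\<lambda>x. Q M x - Q N x))\<^sup>2 \<le> 2 * \<delta> M + 2 * \<delta> N" for M N
  proof -
    have "Re (ip (Q M) (Q M) - ip (Q M) (Q N) - ip (Q N) (Q M) + ip (Q N) (Q N)) \<le>
       cmod (ip (Q M) (Q M) - 1) + cmod (ip (Q M) (Q N) - 1) + cmod (ip (Q N) (Q M) - 1) + cmod (ip (Q N) (Q N) - 1)"
      using abs_Re_le_cmod[of "ip (Q M) (Q M) - 1"] abs_Re_le_cmod[of "ip (Q M) (Q N) - 1"]
        abs_Re_le_cmod[of "ip (Q N) (Q M) - 1"] abs_Re_le_cmod[of "ip (Q N) (Q N) - 1"]
      by simp
    also have "\<dots> \<le> \<delta> M + \<delta> M + \<delta> N + \<delta> N"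
      by (intro add_mono QQ)
    finally show ?thesis by (simp add: ip_norm_diff_sq Q)
  qed
  have cauchy: "\<exists>M. \<forall>m\<ge>M. \<forall>n\<ge>M. ip_norm ip (\<lambda>x. Q m x - Q n x) < e" if "e > 0" for e
  proof -
    have "\<forall>\<^sub>F M in sequentially. \<delta> M < e\<^sup>2 / 4"
      using \<delta> that by (intro order_tendstoD) auto
    then obtain M where M: "\<And>m. m \<ge> M \<Longrightarrow> \<delta> m < e\<^sup>2 / 4"
      by (auto simp: eventually_sequentially)
    show ?thesis
    proof (intro exI[of _ M] allI impI)
      fix m n assume "M \<le> m" "M \<le> n"
      then have "(ip_norm ip (\<lambda>x. Q m x - Q n x))\<^sup>2 < e\<^sup>2"
        using diff[of m n] M[of m] M[of n] by linarith
      then show "ip_norm ip (\<lambda>x. Q m x - Q n x) < e"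
        by (rule power2_less_imp_less) (use that in simp)
    qed
  qed
  have "\<exists>f\<in>H. (\<lambda>n. ip_norm ip (\<lambda>x. Q n x - f x)) \<longlonglongrightarrow> 0"
    by (rule complete[OF Q]) (rule cauchy)
  then obtain R where R: "R \<in> H" and lim: "(\<lambda>n. ip_norm ip (\<lambda>x. Q n x - R x)) \<longlonglongrightarrow> 0"
    by (elim bexE)
  have conv: "(\<lambda>M. ip f (Q M)) \<longlonglongrightarrow> ip f R" if f: "f \<in> H" for f
  proof (rule LIM_zero_cancel, rule Lim_null_comparison)
    show "\<forall>\<^sub>F M in sequentially. norm (ip f (Q M) - ip f R) \<le> ip_norm ip f * ip_norm ip (\<lambda>x. Q M x - R x)"
      using cauchy_schwarz[OF f diff_mem[OF Q R]] by (simp add: ip_diff_right Q R f)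
    show "(\<lambda>M. ip_norm ip f * ip_norm ip (\<lambda>x. Q M x - R x)) \<longlonglongrightarrow> 0"
      using tendsto_mult_right_zero[OF lim] .
  qed
  \<comment> \<open>Norm convergence implies pointwise convergence, while the values of
    \<open>Q M\<close> converge to 1 by the hypothesis on the means.\<close>
  have R1: "R x = 1" if x: "x \<in> X" for x
  proof -
    have "(\<lambda>M. cnj (ip (kernel_section X K x) (Q M))) \<longlonglongrightarrow> cnj (ip (kernel_section X K x) R)"
      by (intro tendsto_cnj conv section_mem x)
    then have "(\<lambda>M. Q M x) \<longlonglongrightarrow> R x"
      using x by (simp add: ip_commute[symmetric] Q R section_mem reproducing)
    moreover have "(\<lambda>M. Q M x) \<longlonglongrightarrow> 1"
    proof (rule LIM_zero_cancel, rule Lim_null_comparison[OF _ \<delta>])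
      show "\<forall>\<^sub>F M in sequentially. norm (Q M x - 1) \<le> \<delta> M"
        using Q1[OF x] by simp
    qed
    ultimately show ?thesis by (rule LIMSEQ_unique)
  qed
  \<comment> \<open>R equals 1 on all point sets, so the sequence converging to
    \<open>ip R R\<close> is constantly 1.\<close>
  have "(\<Sum>y\<in>P M. R y) / of_nat (card (P M)) = 1" for M
  proof -
    have "(\<Sum>y\<in>P M. R y) = (\<Sum>y\<in>P M. 1)"
      using P(3) R1 by (intro sum.cong) auto
    then show ?thesis using P by simp
  qed
  then have "ip R R = 1"
    using conv[OF R] unfolding ipQ[OF R] by (simp only: LIMSEQ_const_iff)
  show thesis
    by (rule that[OF R R1 \<open>ip R R = 1\<close>]) (use conv ipQ in auto)
qed

text \<open>Cauchy-Schwarz gives the upper bound, and the normalized e attains it; if e has norm 0,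
  the zero function does.\<close>

lemma SUP_cmod_ip:
  assumes e: "e \<in> H"
  shows "(SUP f\<in>{f \<in> H. ip_norm ip f \<le> 1}. cmod (ip f e)) = ip_norm ip e"
proof (rule cSup_eq_maximum)
  define c where "c = ip_norm ip e"
  show "ip_norm ip e \<in> (\<lambda>f. cmod (ip f e)) ` {f \<in> H. ip_norm ip f \<le> 1}"
  proof (cases "c = 0")
    case True
    have "cmod (ip (\<lambda>_. 0) e) = ip_norm ip e" "ip_norm ip (\<lambda>_. 0) \<le> 1"
      using True e by (simp_all add: ip_zero_left zero_mem ip_norm_def c_def)
    then show ?thesis by (intro image_eqI[of _ _ "\<lambda>_. 0"]) (auto simp: zero_mem)
  next
    case False
    then have c: "c > 0" using ip_norm_nonneg[OF e] by (simp add: c_def)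
    define f where "f = (\<lambda>x. of_real (1 / c) * e x)"
    have f: "f \<in> H" unfolding f_def using e by (rule scale_mem)
    have "ip f f = of_real (1 / c) * (cnj (of_real (1 / c)) * of_real (c\<^sup>2))"
      unfolding f_def using e by (simp only: ip_scale ip_scale_right scale_mem ip_self c_def)
    also have "\<dots> = 1" using c by (simp add: power2_eq_square)
    finally have "ip_norm ip f \<le> 1" by (simp add: ip_norm_def)
    moreover have "ip f e = of_real (1 / c) * of_real (c\<^sup>2)"
      unfolding f_def using e by (simp only: ip_scale ip_self c_def)
    then have "ip f e = of_real c" using c by (simp add: power2_eq_square)
    then have "cmod (ip f e) = ip_norm ip e" using c by (simp add: c_def)
    ultimately show ?thesis using f by (intro image_eqI[of _ _ f]) auto
  qed
next
  fix x assume "x \<in> (\<lambda>f. cmod (ip f e)) ` {f \<in> H. ip_norm ip f \<le> 1}"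
  then obtain f where f: "f \<in> H" "ip_norm ip f \<le> 1" "x = cmod (ip f e)" by auto
  have "x \<le> ip_norm ip f * ip_norm ip e" using cauchy_schwarz[OF f(1) e] f(3) by simp
  also have "\<dots> \<le> 1 * ip_norm ip e" using f e by (intro mult_right_mono ip_norm_nonneg)
  finally show "x \<le> ip_norm ip e" by simp
qed

text \<open>The error functional is represented by R - Q, where Q is the mean of the kernel sections
  at the nodes. Since R is 1 at every node, both mixed products are 1, and the squared norm 1 - 1 -
  1 + \<open>ip Q Q\<close> remains.\<close>

lemma quadrature_worst_case_sq:
  assumes R: "R \<in> H" "\<And>x. x \<in> X \<Longrightarrow> R x = 1" "ip R R = 1"
    and P: "finite P" "P \<noteq> {}" "p ` P \<subseteq> X"
  shows "(SUP f\<in>{f \<in> H. ip_norm ip f \<le> 1}. cmod (ip f R - (\<Sum>n\<in>P. f (p n)) / of_nat (card P)))\<^sup>2 =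
    Re ((\<Sum>n'\<in>P. \<Sum>n\<in>P. K (p n') (p n)) / (of_nat (card P))\<^sup>2) - 1"
proof -
  define Q where "Q = mean_section P p"
  have Q: "Q \<in> H" unfolding Q_def using P by (intro mean_section_mem)
  have "(\<Sum>n\<in>P. R (p n)) = (\<Sum>n\<in>P. 1)" using P R by (intro sum.cong) auto
  then have RQ: "ip R Q = 1"
    unfolding Q_def using P by (simp add: ip_mean_section R)
  then have QR: "ip Q R = 1" using ip_commute[OF R(1) Q] by simp
  have QQ: "ip Q Q = (\<Sum>n'\<in>P. \<Sum>n\<in>P. K (p n') (p n)) / (of_nat (card P))\<^sup>2"
  proof -
    have "ip Q Q = (\<Sum>n'\<in>P. Q (p n')) / of_nat (card P)"
      using ip_mean_section[OF Q P(1,3)] by (simp add: Q_def)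
    also have "(\<Sum>n'\<in>P. Q (p n')) = (\<Sum>n'\<in>P. (\<Sum>n\<in>P. K (p n') (p n)) / of_nat (card P))"
      unfolding Q_def using P by (intro sum.cong refl mean_section_apply) auto
    finally show ?thesis by (simp add: sum_divide_distrib power2_eq_square)
  qed
  have "(SUP f\<in>{f \<in> H. ip_norm ip f \<le> 1}. cmod (ip f R - (\<Sum>n\<in>P. f (p n)) / of_nat (card P))) =
     (SUP f\<in>{f \<in> H. ip_norm ip f \<le> 1}. cmod (ip f (\<lambda>x. R x - Q x)))"
    using P R Q by (intro SUP_cong) (auto simp: ip_diff_right ip_mean_section Q_def)
  also have "\<dots> = ip_norm ip (\<lambda>x. R x - Q x)"
    by (intro SUP_cmod_ip diff_mem R Q)
  finally show ?thesis
    using R Q by (simp add: ip_norm_diff_sq RQ QR QQ)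
qed

end

section \<open>Base-b grids and integrals over the unit cube\<close>

definition floor_grid :: "nat \<Rightarrow> nat \<Rightarrow> real \<Rightarrow> real" where
  "floor_grid b M x = of_int \<lfloor>x * real b ^ M\<rfloor> / real b ^ M"

definition grid :: "nat \<Rightarrow> nat \<Rightarrow> real set" where
  "grid b M = (\<lambda>a. real a / real b ^ M) ` {..<b ^ M}"

lemma finite_grid [simp]: "finite (grid b M)"
  by (simp add: grid_def)

lemma card_grid: "b \<ge> 2 \<Longrightarrow> card (grid b M) = b ^ M"
  unfolding grid_def by (subst card_image) (auto simp: inj_on_def)

lemma grid_subset: "b \<ge> 2 \<Longrightarrow> grid b M \<subseteq> {0..<1}"
  by (auto simp: grid_def of_nat_power[symmetric] simp del: of_nat_power)

lemma floor_grid_mem: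
  assumes "b \<ge> 2" "x \<in> {0..<1}"
  shows "floor_grid b M x \<in> grid b M"
proof -
  have "0 \<le> \<lfloor>x * real b ^ M\<rfloor>" using assms by simp
  moreover have "x * real b ^ M < 1 * real b ^ M"
    using assms by (intro mult_strict_right_mono) auto
  then have "\<lfloor>x * real b ^ M\<rfloor> < int (b ^ M)" by (simp add: floor_less_iff)
  ultimately have "nat \<lfloor>x * real b ^ M\<rfloor> \<in> {..<b ^ M}"
      "floor_grid b M x = real (nat \<lfloor>x * real b ^ M\<rfloor>) / real b ^ M"
    by (auto simp: floor_grid_def nat_less_iff)
  then show ?thesis unfolding grid_def by blast
qed

lemma floor_grid_eq_iff:
  assumes "b \<ge> 2" "c \<in> grid b M"
  shows "x \<in> {0..<1} \<and> floor_grid b M x = c \<longleftrightarrow> x \<in> {c..<c + 1 / real b ^ M}"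
proof -
  obtain a where a: "a < b ^ M" "c = real a / real b ^ M" using assms by (auto simp: grid_def)
  have "floor_grid b M x = c \<longleftrightarrow> real_of_int \<lfloor>x * real b ^ M\<rfloor> = real_of_int (int a)"
    using assms(1) unfolding floor_grid_def a by simp
  also have "\<dots> \<longleftrightarrow> \<lfloor>x * real b ^ M\<rfloor> = int a"
    by (rule of_int_eq_iff)
  also have "\<dots> \<longleftrightarrow> real a \<le> x * real b ^ M \<and> x * real b ^ M < real a + 1"
    by (simp add: floor_eq_iff)
  also have "\<dots> \<longleftrightarrow> x \<in> {c..<c + 1 / real b ^ M}"
    using assms(1) unfolding a by (simp add: field_simps)
  finally have iff: "floor_grid b M x = c \<longleftrightarrow> x \<in> {c..<c + 1 / real b ^ M}" .
  have "0 \<le> c" using a by simp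
  \<comment> \<open>Since a is an integer below b^M, the cell at c stays inside [0,1); so membership
    in the unit interval follows from membership in the cell.\<close>
  have "real (a + 1) \<le> real (b ^ M)" using a(1) by (intro of_nat_mono) simp
  then have "c + 1 / real b ^ M \<le> 1" using assms(1) unfolding a by (simp add: field_simps)
  with \<open>0 \<le> c\<close> iff show ?thesis by auto
qed

definition cube_floor :: "nat \<Rightarrow> nat \<Rightarrow> nat \<Rightarrow> (nat \<Rightarrow> real) \<Rightarrow> nat \<Rightarrow> real" where
  "cube_floor b s M x = (\<lambda>j\<in>{1..s}. floor_grid b M (x j))"

definition cube_grid :: "nat \<Rightarrow> nat \<Rightarrow> nat \<Rightarrow> (nat \<Rightarrow> real) set" where
  "cube_grid b s M = (\<Pi>\<^sub>E j\<in>{1..s}. grid b M)"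

lemma finite_cube_grid [simp]: "finite (cube_grid b s M)"
  by (simp add: cube_grid_def finite_PiE)

lemma card_cube_grid: "b \<ge> 2 \<Longrightarrow> card (cube_grid b s M) = b ^ (M * s)"
  by (simp add: cube_grid_def card_PiE card_grid power_mult)

lemma cube_grid_nonempty: "b \<ge> 2 \<Longrightarrow> cube_grid b s M \<noteq> {}"
  using card_cube_grid[of b s M] by auto

lemma cube_grid_subset: "b \<ge> 2 \<Longrightarrow> cube_grid b s M \<subseteq> unit_cube s"
  unfolding cube_grid_def unit_cube_def by (intro PiE_mono grid_subset)

lemma cube_floor_mem: "b \<ge> 2 \<Longrightarrow> x \<in> unit_cube s \<Longrightarrow> cube_floor b s M x \<in> cube_grid b s M"
  unfolding cube_grid_def unit_cube_def cube_floor_def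
  by (auto simp: PiE_iff intro!: floor_grid_mem)

lemma cube_floor_eq_iff:
  assumes "b \<ge> 2" "c \<in> cube_grid b s M"
  shows "x \<in> unit_cube s \<and> cube_floor b s M x = c \<longleftrightarrow> x \<in> (\<Pi>\<^sub>E j\<in>{1..s}. {c j..<c j + 1 / real b ^ M})"
proof -
  have c: "c \<in> extensional {1..s}" "\<And>j. j \<in> {1..s} \<Longrightarrow> c j \<in> grid b M"
    using assms(2) by (auto simp: cube_grid_def PiE_iff)
  have eq: "cube_floor b s M x = c \<longleftrightarrow> (\<forall>j\<in>{1..s}. floor_grid b M (x j) = c j)"
  proof
    assume "cube_floor b s M x = c"
    then show "\<forall>j\<in>{1..s}. floor_grid b M (x j) = c j" by (auto simp: cube_floor_def)
  next
    assume *: "\<forall>j\<in>{1..s}. floor_grid b M (x j) = c j"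
    show "cube_floor b s M x = c"
      by (rule extensionalityI[OF _ c(1)]) (use * in \<open>auto simp: cube_floor_def\<close>)
  qed
  have "x \<in> unit_cube s \<and> cube_floor b s M x = c \<longleftrightarrow>
      x \<in> extensional {1..s} \<and> (\<forall>j\<in>{1..s}. x j \<in> {0..<1} \<and> floor_grid b M (x j) = c j)"
    unfolding eq unit_cube_def PiE_iff by blast
  also have "\<dots> \<longleftrightarrow> x \<in> extensional {1..s} \<and> (\<forall>j\<in>{1..s}. x j \<in> {c j..<c j + 1 / real b ^ M})"
    using floor_grid_eq_iff[OF assms(1) c(2)] by blast
  finally show ?thesis by (auto simp: PiE_iff)
qed

lemma emeasure_PiM_lborel_box:
  fixes l u :: "nat \<Rightarrow> real"
  assumes "\<And>j. j \<in> {1..s} \<Longrightarrow> l j \<le> u j"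
  shows "emeasure (\<Pi>\<^sub>M j\<in>{1..s}. lborel) (\<Pi>\<^sub>E j\<in>{1..s}. {l j..<u j}) = ennreal (\<Prod>j=1..s. u j - l j)"
proof -
  interpret product_sigma_finite "\<lambda>_::nat. lborel :: real measure"
    by (simp add: product_sigma_finite_def sigma_finite_lborel)
  have "emeasure (\<Pi>\<^sub>M j\<in>{1..s}. lborel) (\<Pi>\<^sub>E j\<in>{1..s}. {l j..<u j}) = (\<Prod>j=1..s. emeasure lborel {l j..<u j})"
    by (intro emeasure_PiM) auto
  also have "\<dots> = (\<Prod>j=1..s. ennreal (u j - l j))"
    using assms by (intro prod.cong) auto
  also have "\<dots> = ennreal (\<Prod>j=1..s. u j - l j)"
    using assms by (intro prod_ennreal) auto
  finally show ?thesis .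
qed

lemma sets_PiM_lborel_box [measurable]:
  fixes l u :: "nat \<Rightarrow> real"
  shows "(\<Pi>\<^sub>E j\<in>{1..s}. {l j..<u j}) \<in> sets (\<Pi>\<^sub>M j\<in>{1..s}. lborel)"
  by (intro sets_PiM_I_finite) auto

text \<open>The grid mean at level M is the integral of the step function that takes on each cell
  the value of f at its lower corner, all cells having equal volume. Dominated convergence applies,
  and measurability of f on the cube is inherited from these step functions rather than
  assumed.\<close>

lemma grid_means_tendsto_integral:
  fixes f :: "(nat \<Rightarrow> real) \<Rightarrow> complex"
  assumes b: "b \<ge> 2"
    and bounded: "\<And>x. x \<in> unit_cube s \<Longrightarrow> cmod (f x) \<le> C"
    and conv: "\<And>x. x \<in> unit_cube s \<Longrightarrow> (\<lambda>M. f (cube_floor b s M x)) \<longlonglongrightarrow> f x"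
  shows "(\<lambda>M. (\<Sum>y\<in>cube_grid b s M. f y) / of_nat (card (cube_grid b s M)))
    \<longlonglongrightarrow> (LINT x:unit_cube s|(\<Pi>\<^sub>M j\<in>{1..s}. lborel). f x)"
proof -
  let ?L = "\<Pi>\<^sub>M j\<in>{1..s}. lborel :: real measure"
  define B where "B M c = (\<Pi>\<^sub>E j\<in>{1..s}. {c j..<c j + 1 / real b ^ M})" for M :: nat and c :: "nat \<Rightarrow> real"
  have B_iff: "x \<in> B M c \<longleftrightarrow> x \<in> unit_cube s \<and> cube_floor b s M x = c" if "c \<in> cube_grid b s M" for M c x
    using cube_floor_eq_iff[OF b that] by (simp add: B_def)
  have B_sets [measurable]: "B M c \<in> sets ?L" for M c
    unfolding B_def by measurable
  have B_emeasure: "emeasure ?L (B M c) = ennreal (1 / real b ^ (M * s))" for M c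
    unfolding B_def using b by (subst emeasure_PiM_lborel_box) (auto simp: power_mult power_one_over)
  have cube_sets [measurable]: "unit_cube s \<in> sets ?L"
    unfolding unit_cube_def by measurable
  have cube_emeasure: "emeasure ?L (unit_cube s) = 1"
    unfolding unit_cube_def by (subst emeasure_PiM_lborel_box) auto
  define S where "S M x = (\<Sum>c\<in>cube_grid b s M. indicator (B M c) x *\<^sub>R f c)" for M x
  have S_eq: "S M x = indicator (unit_cube s) x *\<^sub>R f (cube_floor b s M x)" for M x
  proof (cases "x \<in> unit_cube s")
    case True
    have "S M x = (\<Sum>c\<in>cube_grid b s M. if c = cube_floor b s M x then f c else 0)"
      unfolding S_def using B_iff True by (intro sum.cong) (auto simp: indicator_def)
    then show ?thesis using True cube_floor_mem[OF b True] by simp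
  next
    case False
    then have "S M x = 0" unfolding S_def using B_iff by (intro sum.neutral) (auto simp: indicator_def)
    then show ?thesis using False by simp
  qed
  have S_integral: "integral\<^sup>L ?L (S M) = (\<Sum>y\<in>cube_grid b s M. f y) / of_nat (card (cube_grid b s M))" for M
  proof -
    have int: "integrable ?L (\<lambda>x. indicator (B M c) x *\<^sub>R f c)" for c
      by (intro integrable_scaleR_left integrable_real_indicator B_sets) (simp add: B_emeasure del: One_nat_def)
    have "integral\<^sup>L ?L (S M) = (\<Sum>c\<in>cube_grid b s M. integral\<^sup>L ?L (\<lambda>x. indicator (B M c) x *\<^sub>R f c))"
      unfolding S_def by (intro Bochner_Integration.integral_sum int)
    also have "\<dots> = (\<Sum>c\<in>cube_grid b s M. (1 / real b ^ (M * s)) *\<^sub>R f c)"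
      by (intro sum.cong) (auto simp: measure_def B_emeasure simp del: One_nat_def)
    finally show ?thesis
      using b by (simp add: card_cube_grid scaleR_conv_of_real sum_divide_distrib)
  qed
  have lim: "(\<lambda>M. S M x) \<longlonglongrightarrow> indicator (unit_cube s) x *\<^sub>R f x" for x
  proof (cases "x \<in> unit_cube s")
    case True
    then show ?thesis using conv by (simp add: S_eq)
  qed (simp add: S_eq)
  have S_meas [measurable]: "S M \<in> borel_measurable ?L" for M
    unfolding S_def by measurable
  have "(\<lambda>M. integral\<^sup>L ?L (S M)) \<longlonglongrightarrow> integral\<^sup>L ?L (\<lambda>x. indicator (unit_cube s) x *\<^sub>R f x)"
  proof (rule integral_dominated_convergence[where w = "\<lambda>x. C * indicator (unit_cube s) x"])
    show "(\<lambda>x. indicator (unit_cube s) x *\<^sub>R f x) \<in> borel_measurable ?L"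
      by (rule borel_measurable_LIMSEQ_metric[OF S_meas lim])
    show "integrable ?L (\<lambda>x. C * indicator (unit_cube s) x)"
      by (intro integrable_mult_right) (simp add: cube_emeasure del: One_nat_def)
    show "AE x in ?L. norm (S M x) \<le> C * indicator (unit_cube s) x" for M
      using bounded cube_grid_subset[OF b, of s M] cube_floor_mem[OF b, of _ s M]
      by (intro AE_I2) (auto simp: S_eq indicator_def)
  qed (simp_all only: S_meas lim AE_I2)
  then show ?thesis unfolding S_integral set_lebesgue_integral_def .
qed

section \<open>Walsh functions at polynomial lattice points\<close>

definition root_char :: "nat \<Rightarrow> int \<Rightarrow> complex" where
  "root_char b k = exp (2 * of_real pi * \<i> * of_int k / of_nat b)"

lemma root_char_0 [simp]: "root_char b 0 = 1"
  by (simp add: root_char_def)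

lemma root_char_add: "root_char b (k + l) = root_char b k * root_char b l"
  unfolding root_char_def by (simp add: exp_add[symmetric] algebra_simps add_divide_distrib)

lemma norm_root_char [simp]: "cmod (root_char b k) = 1"
  unfolding root_char_def by (simp add: norm_exp_eq_Re)

lemma root_char_mod:
  assumes "b > 0"
  shows "root_char b (k mod int b) = root_char b k"
proof -
  have "root_char b k = root_char b (int b * (k div int b) + k mod int b)" by simp
  also have "\<dots> = root_char b (int b * (k div int b)) * root_char b (k mod int b)"
    by (rule root_char_add)
  also have "root_char b (int b * (k div int b)) = exp (\<i> * (of_int (k div int b) * (of_real pi * 2)))"
    unfolding root_char_def using assms by (simp add: mult_ac)
  also have "\<dots> = 1" by (rule exp_2pi_1_int)
  finally show ?thesis by simp
qed

lemma root_char_neq_1: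
  assumes "0 < k" "k < int b"
  shows "root_char b k \<noteq> 1"
proof
  assume "root_char b k = 1"
  then obtain n :: int where "2 * pi * real_of_int k / real b = of_int (2 * n) * pi"
    unfolding root_char_def exp_eq_1 by auto
  then have "real_of_int k = real_of_int (n * int b)" using assms by (simp add: field_simps)
  then have "k = n * int b" by (simp only: of_int_eq_iff)
  then show False using assms
    by (metis dvd_triv_right zdvd_not_zless)
qed

text \<open>The standard nontrivial additive character of the field with b elements; through it
  products of Walsh values become values at sums.\<close>

definition mod_char :: "'b::prime_card mod_ring \<Rightarrow> complex" where
  "mod_char c = root_char CARD('b) (to_int_mod_ring c)"

lemma card_ge_2: "CARD('b::prime_card) \<ge> 2"
  using prime_card prime_ge_2_nat by blast

lemma to_int_mod_ring_of_int:
  "to_int_mod_ring (of_int k :: 'b::prime_card mod_ring) = k mod int CARD('b)"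
  unfolding of_int_of_int_mod_ring by transfer simp

lemma to_int_mod_ring_bounds:
  "0 \<le> to_int_mod_ring (c :: 'b::prime_card mod_ring)" "to_int_mod_ring c < int CARD('b)"
  using range_to_int_mod_ring[where 'a = 'b] rangeI[of to_int_mod_ring c] by auto

lemma of_int_to_int_mod_ring: "of_int (to_int_mod_ring c) = (c :: 'b::prime_card mod_ring)"
  by (simp add: of_int_of_int_mod_ring)

lemma mod_char_of_int: "mod_char (of_int k :: 'b::prime_card mod_ring) = root_char CARD('b) k"
  unfolding mod_char_def to_int_mod_ring_of_int by (intro root_char_mod) simp

lemma mod_char_add: "mod_char (c + d) = mod_char c * mod_char (d :: 'b::prime_card mod_ring)"
  using mod_char_of_int[where 'b = 'b, of "to_int_mod_ring c + to_int_mod_ring d"]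
  by (simp add: of_int_to_int_mod_ring root_char_add mod_char_def)

lemma mod_char_0 [simp]: "mod_char 0 = 1"
  using mod_char_of_int[of 0] by simp

lemma mod_char_sum: "mod_char (\<Sum>x\<in>A. f x) = (\<Prod>x\<in>A. mod_char (f x))"
  by (induction A rule: infinite_finite_induct) (auto simp: mod_char_add)

lemma mod_char_neq_1:
  assumes "c \<noteq> 0"
  shows "mod_char (c :: 'b::prime_card mod_ring) \<noteq> 1"
proof -
  have "to_int_mod_ring c \<noteq> 0" using assms of_int_to_int_mod_ring[of c] by auto
  then have "0 < to_int_mod_ring c" using to_int_mod_ring_bounds(1)[of c] by linarith
  then show ?thesis unfolding mod_char_def
    using to_int_mod_ring_bounds(2)[of c] by (rule root_char_neq_1)
qed

section \<open>Counting polynomials of bounded degree\<close>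

text \<open>The sets \<open>A i\<close> may vary with the index so that one bijection counts both
  all polynomials of small degree and those with nonzero constant coefficient. For m = 0 the degree
  condition would exclude even the zero polynomial.\<close>

lemma bij_betw_coeffs:
  fixes A :: "nat \<Rightarrow> 'a::zero set"
  assumes "m \<ge> 1"
  shows "bij_betw (\<lambda>v. \<lambda>i\<in>{..<m}. poly.coeff v i) {v. degree v < m \<and> (\<forall>i<m. poly.coeff v i \<in> A i)}
    (\<Pi>\<^sub>E i\<in>{..<m}. A i)"
proof (rule bij_betw_imageI)
  show "inj_on (\<lambda>v. \<lambda>i\<in>{..<m}. poly.coeff v i) {v. degree v < m \<and> (\<forall>i<m. poly.coeff v i \<in> A i)}"
  proof (rule inj_onI)
    fix v v' :: "'a poly"
    assume *: "v \<in> {v. degree v < m \<and> (\<forall>i<m. poly.coeff v i \<in> A i)}" "v' \<in> {v. degree v < m \<and> (\<forall>i<m. poly.coeff v i \<in> A i)}"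
      "(\<lambda>i\<in>{..<m}. poly.coeff v i) = (\<lambda>i\<in>{..<m}. poly.coeff v' i)"
    show "v = v'"
    proof (rule poly_eqI)
      fix i
      show "poly.coeff v i = poly.coeff v' i"
      proof (cases "i < m")
        case True
        then show ?thesis using fun_cong[OF *(3), of i] by simp
      next
        case False
        then have "degree v < i" "degree v' < i" using * by auto
        then show ?thesis by (simp add: coeff_eq_0)
      qed
    qed
  qed
next
  show "(\<lambda>v. \<lambda>i\<in>{..<m}. poly.coeff v i) ` {v. degree v < m \<and> (\<forall>i<m. poly.coeff v i \<in> A i)} = (\<Pi>\<^sub>E i\<in>{..<m}. A i)"
  proof (intro equalityI subsetI)
    fix c assume c: "c \<in> (\<Pi>\<^sub>E i\<in>{..<m}. A i)"
    define v where "v = Poly (map c [0..<m])"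
    have cf: "poly.coeff v i = (if i < m then c i else 0)" for i
      by (simp add: v_def nth_default_def coeff_Poly_eq)
    have "degree v \<le> m - 1" using assms by (intro degree_le) (auto simp: cf)
    then have "degree v < m" using assms by simp
    moreover have "(\<lambda>i\<in>{..<m}. poly.coeff v i) = c"
      using c by (intro extensionalityI[of _ "{..<m}"]) (auto simp: cf PiE_iff)
    ultimately show "c \<in> (\<lambda>v. \<lambda>i\<in>{..<m}. poly.coeff v i) ` {v. degree v < m \<and> (\<forall>i<m. poly.coeff v i \<in> A i)}"
      using c by (intro image_eqI[of _ _ v]) (auto simp: cf PiE_iff)
  qed (auto split: if_splits)
qed

lemma finite_polys_degree_less [simp]:
  "finite {v :: 'a::{zero, finite} poly. degree v < m}"
proof (cases "m \<ge> 1")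
  case True
  show ?thesis
    using bij_betw_finite[OF bij_betw_coeffs[OF True, of "\<lambda>_. UNIV :: 'a set"]]
    by (simp add: finite_PiE)
qed auto

lemma card_polys_degree_less:
  assumes "m \<ge> 1"
  shows "card {v :: 'b::prime_card mod_ring poly. degree v < m} = CARD('b) ^ m"
  using bij_betw_same_card[OF bij_betw_coeffs[OF assms, of "\<lambda>_. UNIV :: 'b mod_ring set"]]
  by (simp add: card_PiE)

lemma coeff_mod_monom:
  fixes v :: "'a::field poly"
  assumes "i < m"
  shows "poly.coeff (v mod Polynomial.monom 1 m) i = poly.coeff v i"
proof -
  have "poly.coeff v i = poly.coeff (Polynomial.monom 1 m * (v div Polynomial.monom 1 m) + v mod Polynomial.monom 1 m) i"
    by simp
  also have "\<dots> = poly.coeff (v mod Polynomial.monom 1 m) i"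
    using assms by (simp only: coeff_add coeff_monom_mult) simp
  finally show ?thesis by simp
qed

section \<open>Base-b digits of the lattice points\<close>

lemma digit_sum_less:
  fixes a :: "nat \<Rightarrow> nat"
  assumes "\<And>i. a i < b"
  shows "(\<Sum>i<m. a i * b ^ i) < b ^ m"
proof (induction m)
  case (Suc m)
  have "(\<Sum>i<Suc m. a i * b ^ i) < b ^ m + a m * b ^ m" using Suc by simp
  also have "\<dots> = Suc (a m) * b ^ m" by simp
  also have "\<dots> \<le> b * b ^ m" using assms[of m] by (intro mult_right_mono) auto
  finally show ?case by simp
qed auto

lemma digit_sum_digit:
  fixes a :: "nat \<Rightarrow> nat"
  assumes "\<And>i. a i < b" "k < m"
  shows "((\<Sum>i<m. a i * b ^ i) div b ^ k) mod b = a k"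
  using assms(2)
proof (induction m)
  case (Suc m)
  let ?S = "\<Sum>i<m. a i * b ^ i"
  have b: "b > 0" using assms(1)[of 0] by auto
  show ?case
  proof (cases "k = m")
    case True
    have "(?S + a m * b ^ m) div b ^ m = a m"
      using digit_sum_less[of a b m, OF assms(1)] b by simp
    then show ?thesis using True assms(1) by simp
  next
    case False
    then have k: "k < m" using Suc.prems by simp
    then have "b ^ m = b ^ k * (b * b ^ (m - Suc k))"
      by (simp flip: power_add power_Suc)
    then have eq: "?S + a m * b ^ m = ?S + b ^ k * (a m * b ^ (m - Suc k) * b)" by simp
    have "(?S + a m * b ^ m) div b ^ k = a m * b ^ (m - Suc k) * b + ?S div b ^ k"
      unfolding eq by (rule div_mult_self2) (use b in simp)
    then show ?thesis using Suc.IH[OF k] by simp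
  qed
qed auto

text \<open>The numerator of \<open>nu m v\<close> over the denominator b^m; its base-b digits are
  the first m coefficients of v.\<close>

definition nu_num :: "nat \<Rightarrow> 'b::prime_card mod_ring poly \<Rightarrow> nat" where
  "nu_num m v = (\<Sum>i<m. nat (to_int_mod_ring (poly.coeff v i)) * CARD('b) ^ i)"

lemma nat_to_int_mod_ring_less: "nat (to_int_mod_ring (c :: 'b::prime_card mod_ring)) < CARD('b)"
  using to_int_mod_ring_bounds[of c] by linarith

lemma nu_num_less: "nu_num m (v :: 'b::prime_card mod_ring poly) < CARD('b) ^ m"
  unfolding nu_num_def by (intro digit_sum_less nat_to_int_mod_ring_less)

lemma nu_num_digit:
  "k < m \<Longrightarrow> int (nu_num m v div CARD('b) ^ k mod CARD('b)) =
    to_int_mod_ring (poly.coeff (v :: 'b::prime_card mod_ring poly) k)"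
  unfolding nu_num_def
  by (subst digit_sum_digit) (auto simp: nat_to_int_mod_ring_less to_int_mod_ring_bounds)

lemma nu_eq: "nu m (v :: 'b::prime_card mod_ring poly) = real (nu_num m v) / real CARD('b) ^ m"
proof -
  have "nu m v = (\<Sum>i<m. real (nat (to_int_mod_ring (poly.coeff v i)) * CARD('b) ^ i) / real CARD('b) ^ m)"
    unfolding nu_def
  proof (intro sum.cong refl)
    fix i assume i: "i \<in> {..<m}"
    then have "real CARD('b) ^ m = real CARD('b) ^ (m - i) * real CARD('b) ^ i"
      by (simp flip: power_add)
    then show "of_int (to_int_mod_ring (poly.coeff (v mod Polynomial.monom 1 m) i)) / real CARD('b) ^ (m - i) =
        real (nat (to_int_mod_ring (poly.coeff v i)) * CARD('b) ^ i) / real CARD('b) ^ m"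
      using i by (simp add: coeff_mod_monom to_int_mod_ring_bounds)
  qed
  then show ?thesis by (simp add: nu_num_def sum_divide_distrib)
qed

lemma nu_mem: "nu m (v :: 'b::prime_card mod_ring poly) \<in> grid CARD('b) m"
  unfolding nu_eq grid_def using nu_num_less by blast

text \<open>Dividing the numerator by b^m reverses the order of its digits, so the digit at position
  i + 1 is the coefficient of x^(m-1-i). Further digits vanish because the expansion is
  finite.\<close>

lemma frac_digit_nu:
  fixes v :: "'b::prime_card mod_ring poly"
  shows "frac_digit CARD('b) (nu m v) (Suc i) = (if i < m then to_int_mod_ring (poly.coeff v (m - Suc i)) else 0)"
proof (cases "i < m")
  case True
  then have "real CARD('b) ^ m = real CARD('b) ^ (m - Suc i) * real CARD('b) ^ Suc i"
    by (simp flip: power_add power_Suc)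
  then have "nu m v * real CARD('b) ^ Suc i = real (nu_num m v) / real (CARD('b) ^ (m - Suc i))"
    unfolding nu_eq by simp
  then have "\<lfloor>nu m v * real CARD('b) ^ Suc i\<rfloor> = int (nu_num m v div CARD('b) ^ (m - Suc i))"
    by (simp only: floor_divide_of_nat_eq)
  then have "frac_digit CARD('b) (nu m v) (Suc i) = int (nu_num m v div CARD('b) ^ (m - Suc i) mod CARD('b))"
    unfolding frac_digit_def by (simp only: zmod_int)
  then show ?thesis using True by (simp add: nu_num_digit)
next
  case False
  \<comment> \<open>Beyond position m the scaled value is an integer multiple of b, so its residue
    is 0.\<close>
  then have "real CARD('b) ^ Suc i = real CARD('b) ^ m * real CARD('b) ^ Suc (i - m)"
    by (simp flip: power_add power_Suc)
  then have "nu m v * real CARD('b) ^ Suc i = of_int (int (nu_num m v * CARD('b) ^ (i - m)) * int CARD('b))"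
    unfolding nu_eq by simp
  then have "\<lfloor>nu m v * real CARD('b) ^ Suc i\<rfloor> = int (nu_num m v * CARD('b) ^ (i - m)) * int CARD('b)"
    by (simp only: floor_of_int)
  then show ?thesis using False unfolding frac_digit_def by simp
qed

text \<open>The digits of the image recover all coefficients, and surjectivity follows because both
  sides have b^m elements.\<close>

lemma bij_betw_nu:
  assumes "m \<ge> 1"
  shows "bij_betw (nu m) {v :: 'b::prime_card mod_ring poly. degree v < m} (grid CARD('b) m)"
proof -
  have inj: "inj_on (nu m) {v :: 'b mod_ring poly. degree v < m}"
  proof (rule inj_onI)
    fix v v' :: "'b mod_ring poly"
    assume *: "v \<in> {v. degree v < m}" "v' \<in> {v. degree v < m}" "nu m v = nu m v'"
    show "v = v'"
    proof (rule poly_eqI)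
      fix k
      show "poly.coeff v k = poly.coeff v' k"
      proof (cases "k < m")
        case True
        then have k: "m - Suc k < m" "m - Suc (m - Suc k) = k" by auto
        have "to_int_mod_ring (poly.coeff v k) = to_int_mod_ring (poly.coeff v' k)"
          using frac_digit_nu[of m v "m - Suc k"] frac_digit_nu[of m v' "m - Suc k"] *(3) k
          by (simp only: if_True)
        then show ?thesis by (metis of_int_to_int_mod_ring)
      next
        case False
        then have "degree v < k" "degree v' < k" using * by auto
        then show ?thesis by (simp add: coeff_eq_0)
      qed
    qed
  qed
  moreover have "nu m ` {v :: 'b mod_ring poly. degree v < m} = grid CARD('b) m"
  proof (rule card_subset_eq)
    show "nu m ` {v :: 'b mod_ring poly. degree v < m} \<subseteq> grid CARD('b) m" using nu_mem by blast
    show "card (nu m ` {v :: 'b mod_ring poly. degree v < m}) = card (grid CARD('b) m)"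
      using inj assms by (simp add: card_image card_polys_degree_less card_grid card_ge_2)
  qed simp
  ultimately show ?thesis by (simp add: bij_betw_def)
qed

section \<open>Walsh functions as characters of polynomials\<close>

definition trunc_poly :: "nat \<Rightarrow> nat \<Rightarrow> 'b::prime_card mod_ring poly" where
  "trunc_poly m h = (\<Sum>i<m. Polynomial.monom (of_nat (nat_digit CARD('b) h i)) i)"

lemma coeff_trunc_poly:
  "poly.coeff (trunc_poly m h :: 'b::prime_card mod_ring poly) i =
    (if i < m then of_nat (nat_digit CARD('b) h i) else 0)"
  unfolding trunc_poly_def by (simp add: coeff_sum if_distrib)

lemma less_power_psi:
  assumes "b \<ge> 2"
  shows "h < b ^ Suc (nat (psi b h))"
proof (cases "h = 0")
  case False
  have nonneg: "0 \<le> psi b h" unfolding psi_def using assms False by simp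
  have "log (real b) (real h) < of_int (psi b h) + 1" unfolding psi_def by linarith
  then have "real h < real b powr (of_int (psi b h) + 1)"
    using assms False by (simp add: log_less_iff)
  also have "\<dots> = real b powr (real (Suc (nat (psi b h))))" using nonneg by (simp add: add.commute)
  also have "\<dots> = real (b ^ Suc (nat (psi b h)))" using assms by (subst powr_realpow) auto
  finally show ?thesis by (simp only: of_nat_less_iff)
qed (use assms in simp)

lemma nat_digit_eq_0:
  assumes "b \<ge> 2" "nat (psi b h) < i"
  shows "nat_digit b h i = 0"
proof -
  have "h < b ^ Suc (nat (psi b h))" using assms by (intro less_power_psi)
  also have "\<dots> \<le> b ^ i" using assms by (intro power_increasing) auto
  finally show ?thesis by (simp add: nat_digit_def)
qed

lemma wal_root_char:
  "wal b h x = root_char b (\<Sum>i\<le>nat (psi b h). frac_digit b x (Suc i) * int (nat_digit b h i))"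
  by (simp add: wal_def root_char_def)

lemma norm_wal [simp]: "cmod (wal b h x) = 1"
  by (simp add: wal_root_char)

text \<open>Because \<open>nu\<close> reverses the coefficients, the digit pairing in the Walsh
  function is a convolution, namely the coefficient of x^(m-1) in a product.\<close>

lemma wal_nu:
  fixes v :: "'b::prime_card mod_ring poly"
  assumes m: "m \<ge> 1"
  shows "wal CARD('b) h (nu m v) = mod_char (poly.coeff (trunc_poly m h * v) (m - 1))"
proof -
  let ?b = "CARD('b)"
  \<comment> \<open>The range is changed through the larger of both lengths: digits of h vanish
    beyond \<open>psi\<close>, digits of the point beyond m.\<close>
  have "(\<Sum>i\<le>nat (psi ?b h). frac_digit ?b (nu m v) (Suc i) * int (nat_digit ?b h i)) =
      (\<Sum>i<max m (Suc (nat (psi ?b h))). frac_digit ?b (nu m v) (Suc i) * int (nat_digit ?b h i))"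
    by (intro sum.mono_neutral_left) (auto simp: nat_digit_eq_0 card_ge_2)
  also have "\<dots> = (\<Sum>i<m. frac_digit ?b (nu m v) (Suc i) * int (nat_digit ?b h i))"
    by (intro sum.mono_neutral_right) (auto simp: frac_digit_nu)
  also have "\<dots> = (\<Sum>i<m. to_int_mod_ring (poly.coeff v (m - Suc i)) * int (nat_digit ?b h i))"
    by (intro sum.cong) (auto simp: frac_digit_nu)
  finally have "wal ?b h (nu m v) =
      mod_char (of_int (\<Sum>i<m. to_int_mod_ring (poly.coeff v (m - Suc i)) * int (nat_digit ?b h i)) :: 'b mod_ring)"
    by (simp only: wal_root_char mod_char_of_int)
  also have "(of_int (\<Sum>i<m. to_int_mod_ring (poly.coeff v (m - Suc i)) * int (nat_digit ?b h i)) :: 'b mod_ring) =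
      (\<Sum>i<m. poly.coeff v (m - Suc i) * of_nat (nat_digit ?b h i))"
    by (simp add: of_int_to_int_mod_ring)
  also have "\<dots> = (\<Sum>i\<le>m - 1. poly.coeff (trunc_poly m h) i * poly.coeff v (m - 1 - i))"
    using m by (intro sum.cong) (auto simp: coeff_trunc_poly mult.commute)
  also have "\<dots> = poly.coeff (trunc_poly m h * v) (m - 1)"
    by (simp add: coeff_mult)
  finally show ?thesis .
qed

text \<open>Both conditions say that the lowest t digits of h vanish, and t <= m ensures that the
  truncation keeps these digits.\<close>

lemma monom_dvd_trunc_poly_iff:
  assumes "t \<le> m"
  shows "Polynomial.monom 1 t dvd (trunc_poly m h :: 'b::prime_card mod_ring poly) \<longleftrightarrow> CARD('b) ^ t dvd h"
proof -
  let ?b = "CARD('b)"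
  have digit: "(of_nat (nat_digit ?b h i) :: 'b mod_ring) = 0 \<longleftrightarrow> nat_digit ?b h i = 0" for i
  proof
    assume "(of_nat (nat_digit ?b h i) :: 'b mod_ring) = 0"
    then have "?b dvd nat_digit ?b h i" by (rule of_nat_0_mod_ring_dvd)
    moreover have "nat_digit ?b h i < ?b" by (simp add: nat_digit_def)
    ultimately show "nat_digit ?b h i = 0" using nat_dvd_not_less by blast
  qed simp
  have "Polynomial.monom 1 t dvd (trunc_poly m h :: 'b mod_ring poly) \<longleftrightarrow> (\<forall>i<t. nat_digit ?b h i = 0)"
    using assms by (auto simp: monom_1_dvd_iff' coeff_trunc_poly digit)
  also have "\<dots> \<longleftrightarrow> ?b ^ t dvd h"
  proof (induction t)
    case (Suc t)
    have "(\<forall>i<Suc t. nat_digit ?b h i = 0) \<longleftrightarrow> ?b ^ t dvd h \<and> ?b dvd h div ?b ^ t"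
      using Suc by (auto simp: less_Suc_eq nat_digit_def dvd_eq_mod_eq_0)
    also have "\<dots> \<longleftrightarrow> ?b ^ Suc t dvd h"
    proof
      assume "?b ^ t dvd h \<and> ?b dvd h div ?b ^ t"
      then have "?b ^ t * ?b dvd ?b ^ t * (h div ?b ^ t)" "?b ^ t * (h div ?b ^ t) = h"
        by (auto intro: mult_dvd_mono)
      then show "?b ^ Suc t dvd h" by (simp add: mult.commute)
    next
      assume "?b ^ Suc t dvd h"
      then obtain k where "h = ?b ^ t * (?b * k)" by (auto simp: dvd_def mult_ac)
      then show "?b ^ t dvd h \<and> ?b dvd h div ?b ^ t" by simp
    qed
    finally show ?case .
  qed simp
  finally show ?thesis .
qed

text \<open>Orthogonality of characters: if x^m does not divide P, a suitable translation of n
  multiplies the sum by a root of unity different from 1, so the sum vanishes.\<close>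

lemma sum_mod_char_coeff:
  fixes P :: "'b::prime_card mod_ring poly"
  assumes m: "m \<ge> 1"
  shows "(\<Sum>n | degree n < m. mod_char (poly.coeff (n * P) (m - 1))) =
    (if Polynomial.monom 1 m dvd P then of_nat (CARD('b) ^ m) else 0)"
proof (cases "Polynomial.monom 1 m dvd P")
  case True
  have "(\<Sum>n | degree n < m. mod_char (poly.coeff (n * P) (m - 1))) = (\<Sum>n\<in>{n :: 'b mod_ring poly. degree n < m}. 1)"
  proof (intro sum.cong refl)
    fix n :: "'b mod_ring poly"
    have "Polynomial.monom 1 m dvd n * P" using True by simp
    then have "poly.coeff (n * P) (m - 1) = 0" using m by (simp add: monom_1_dvd_iff')
    then show "mod_char (poly.coeff (n * P) (m - 1)) = 1" by simp
  qed
  then show ?thesis using True m by (simp add: card_polys_degree_less)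
next
  case False
  then obtain k where k: "k < m" "poly.coeff P k \<noteq> 0" by (auto simp: monom_1_dvd_iff')
  \<comment> \<open>This monomial moves the nonzero coefficient of P at index k to index m -
    1.\<close>
  define n0 :: "'b mod_ring poly" where "n0 = Polynomial.monom 1 (m - 1 - k)"
  have deg: "degree n0 < m" using m k by (simp add: n0_def degree_monom_eq)
  have n0: "poly.coeff (n0 * P) (m - 1) = poly.coeff P k"
    using k by (simp add: n0_def coeff_monom_mult)
  let ?S = "\<Sum>n | degree n < m. mod_char (poly.coeff (n * P) (m - 1))"
  have "?S = (\<Sum>n | degree n < m. mod_char (poly.coeff ((n + n0) * P) (m - 1)))"
    by (rule sum.reindex_bij_witness[of _ "\<lambda>n. n + n0" "\<lambda>n. n - n0"])
       (use deg in \<open>auto intro: degree_add_less degree_diff_less\<close>)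
  also have "\<dots> = (\<Sum>n | degree n < m. mod_char (poly.coeff P k) * mod_char (poly.coeff (n * P) (m - 1)))"
    by (simp only: distrib_right coeff_add mod_char_add n0 mult.commute[of "mod_char (poly.coeff P k)"])
  also have "\<dots> = mod_char (poly.coeff P k) * ?S"
    by (rule sum_distrib_left[symmetric])
  finally have "?S * (mod_char (poly.coeff P k) - 1) = 0" by (simp add: algebra_simps)
  then show ?thesis using mod_char_neq_1[OF k(2)] False by simp
qed

lemma prod_wal_lattice:
  fixes g :: "nat \<Rightarrow> 'b::prime_card mod_ring poly"
  assumes "m \<ge> 1"
  shows "(\<Prod>j\<in>u. wal CARD('b) (h j) (nu m (n * g j))) =
    mod_char (poly.coeff (n * (\<Sum>j\<in>u. trunc_poly m (h j) * g j)) (m - 1))"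
proof -
  have "(\<Prod>j\<in>u. wal CARD('b) (h j) (nu m (n * g j))) =
      mod_char (\<Sum>j\<in>u. poly.coeff (trunc_poly m (h j) * (n * g j)) (m - 1))"
    using assms by (simp add: wal_nu mod_char_sum)
  also have "(\<Sum>j\<in>u. poly.coeff (trunc_poly m (h j) * (n * g j)) (m - 1)) =
      poly.coeff (n * (\<Sum>j\<in>u. trunc_poly m (h j) * g j)) (m - 1)"
    by (simp add: coeff_sum sum_distrib_left mult_ac)
  finally show ?thesis .
qed

text \<open>The grid is the image of the polynomials of degree below M under \<open>nu\<close>, and
  0 < h < b^M prevents x^M from dividing the truncation of h; character orthogonality
  applies.\<close>

lemma sum_wal_grid:
  assumes "h \<ge> 1" "h < CARD('b::prime_card) ^ M"
  shows "(\<Sum>x\<in>grid CARD('b) M. wal CARD('b) h x) = 0"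
proof -
  have M: "M \<ge> 1" using assms by (cases M) auto
  have "\<not> CARD('b) ^ M dvd h" using assms nat_dvd_not_less by auto
  then have nd: "\<not> Polynomial.monom 1 M dvd (trunc_poly M h :: 'b mod_ring poly)"
    by (simp add: monom_dvd_trunc_poly_iff)
  have "(\<Sum>x\<in>grid CARD('b) M. wal CARD('b) h x) =
      (\<Sum>v | degree v < M. wal CARD('b) h (nu M (v :: 'b mod_ring poly)))"
    using sum.reindex_bij_betw[OF bij_betw_nu[OF M, where 'b = 'b], of "wal CARD('b) h"] by simp
  also have "\<dots> = (\<Sum>v | degree v < M. mod_char (poly.coeff (v * (trunc_poly M h :: 'b mod_ring poly)) (M - 1)))"
    using M by (intro sum.cong) (auto simp: wal_nu mult.commute)
  also have "\<dots> = 0" using M nd by (subst sum_mod_char_coeff) auto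
  finally show ?thesis .
qed

lemma frac_digit_floor_grid:
  assumes "b \<ge> 2" "i \<le> M"
  shows "frac_digit b (floor_grid b M x) i = frac_digit b x i"
proof -
  have M: "real b ^ M = real b ^ (M - i) * real b ^ i" using assms by (simp flip: power_add)
  have "\<lfloor>floor_grid b M x * real b ^ i\<rfloor> = \<lfloor>real_of_int \<lfloor>x * real b ^ M\<rfloor> / real_of_int (int b ^ (M - i))\<rfloor>"
    unfolding floor_grid_def M using assms by simp
  also have "\<dots> = \<lfloor>x * real b ^ M\<rfloor> div int b ^ (M - i)"
    by (rule floor_divide_of_int_eq)
  also have "\<dots> = \<lfloor>x * real b ^ M / real_of_int (int b ^ (M - i))\<rfloor>"
    by (rule floor_divide_real_eq_div[symmetric]) simp
  also have "x * real b ^ M / real_of_int (int b ^ (M - i)) = x * real b ^ i"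
    unfolding M using assms by simp
  finally show ?thesis by (simp add: frac_digit_def)
qed

lemma psi_less:
  assumes "b \<ge> 2" "h \<ge> 1" "h < b ^ M"
  shows "nat (psi b h) < M"
proof -
  have "log (real b) (real h) < real M"
    using assms by (subst log_less_iff) (auto simp: powr_realpow simp flip: of_nat_power)
  moreover have "0 \<le> log (real b) (real h)" using assms by simp
  ultimately show ?thesis unfolding psi_def by linarith
qed

text \<open>A frequency below b^M has at most M digits and therefore reads only digits that the
  truncation of x preserves.\<close>

lemma wal_floor_grid:
  assumes "b \<ge> 2" "h \<ge> 1" "h < b ^ M"
  shows "wal b h (floor_grid b M x) = wal b h x"
proof -
  have "nat (psi b h) < M" using assms by (rule psi_less)
  then have "(\<Sum>i\<le>nat (psi b h). frac_digit b (floor_grid b M x) (Suc i) * int (nat_digit b h i)) =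
     (\<Sum>i\<le>nat (psi b h). frac_digit b x (Suc i) * int (nat_digit b h i))"
    using assms by (intro sum.cong) (auto simp: frac_digit_floor_grid)
  then show ?thesis by (simp add: wal_root_char)
qed

section \<open>The worst-case error formula\<close>

definition kernel_term :: "nat \<Rightarrow> real \<Rightarrow> nat set \<Rightarrow> (nat \<Rightarrow> real) \<Rightarrow> (nat \<Rightarrow> real) \<Rightarrow> (nat \<Rightarrow> nat) \<Rightarrow> complex" where
  "kernel_term b \<alpha> u x y h = of_real (\<Prod>j\<in>u. walsh_weight b \<alpha> (h j)) *
     (\<Prod>j\<in>u. wal b (h j) (x j)) * cnj (\<Prod>j\<in>u. wal b (h j) (y j))"

definition walsh_kernel_trunc ::
  "nat \<Rightarrow> real \<Rightarrow> (nat set \<Rightarrow> real) \<Rightarrow> nat \<Rightarrow> nat \<Rightarrow> (nat \<Rightarrow> real) \<Rightarrow> (nat \<Rightarrow> real) \<Rightarrow> complex" where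
  "walsh_kernel_trunc b \<alpha> \<gamma> s L x y =
     1 + (\<Sum>u\<in>{u. u \<noteq> {} \<and> u \<subseteq> {1..s}}. of_real (\<gamma> u) * (\<Sum>h\<in>freq_box b u L. kernel_term b \<alpha> u x y h))"

text \<open>The weighted mass of the frequencies outside the box. As Walsh functions have modulus 1,
  it bounds the truncation error for all pairs of points at once.\<close>

definition kernel_tail :: "nat \<Rightarrow> real \<Rightarrow> (nat set \<Rightarrow> real) \<Rightarrow> nat \<Rightarrow> nat \<Rightarrow> real" where
  "kernel_tail b \<alpha> \<gamma> s L =
     (\<Sum>u\<in>{u. u \<noteq> {} \<and> u \<subseteq> {1..s}}. \<gamma> u *
       ((\<Sum>\<^sub>\<infinity>h\<in>(\<Pi>\<^sub>E j\<in>u. {1..}). \<Prod>j\<in>u. walsh_weight b \<alpha> (h j)) -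
        (\<Sum>h\<in>freq_box b u L. \<Prod>j\<in>u. walsh_weight b \<alpha> (h j))))"

lemma walsh_kernel_eq:
  "walsh_kernel b \<alpha> \<gamma> s x y =
     1 + (\<Sum>u\<in>{u. u \<noteq> {} \<and> u \<subseteq> {1..s}}. of_real (\<gamma> u) * (\<Sum>\<^sub>\<infinity>h\<in>(\<Pi>\<^sub>E j\<in>u. {1..}). kernel_term b \<alpha> u x y h))"
  by (simp add: walsh_kernel_def kernel_term_def)

lemma norm_kernel_term: "cmod (kernel_term b \<alpha> u x y h) = (\<Prod>j\<in>u. walsh_weight b \<alpha> (h j))"
  by (simp add: kernel_term_def norm_mult flip: prod_norm of_real_prod)

lemma walsh_kernel_trunc_dist:
  assumes b: "b \<ge> 2" and \<alpha>: "\<alpha> > 1" and \<gamma>: "\<And>u. u \<subseteq> {1..s} \<Longrightarrow> \<gamma> u \<ge> 0"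
  shows "cmod (walsh_kernel b \<alpha> \<gamma> s x y - walsh_kernel_trunc b \<alpha> \<gamma> s L x y) \<le> kernel_tail b \<alpha> \<gamma> s L"
proof -
  let ?U = "{u. u \<noteq> {} \<and> u \<subseteq> {1..s}}"
  have dist: "cmod ((\<Sum>\<^sub>\<infinity>h\<in>(\<Pi>\<^sub>E j\<in>u. {1..}). kernel_term b \<alpha> u x y h) - (\<Sum>h\<in>freq_box b u L. kernel_term b \<alpha> u x y h))
      \<le> (\<Sum>\<^sub>\<infinity>h\<in>(\<Pi>\<^sub>E j\<in>u. {1..}). \<Prod>j\<in>u. walsh_weight b \<alpha> (h j)) - (\<Sum>h\<in>freq_box b u L. \<Prod>j\<in>u. walsh_weight b \<alpha> (h j))"
    if u: "u \<in> ?U" for u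
  proof -
    let ?A = "\<Pi>\<^sub>E j\<in>u. {1..} :: nat set" and ?B = "freq_box b u L"
    have fin: "finite u" using u finite_subset by auto
    have B: "finite ?B" "?B \<subseteq> ?A" using fin freq_box_subset by auto
    have sumW: "(\<lambda>h. \<Prod>j\<in>u. walsh_weight b \<alpha> (h j)) summable_on A" if "A \<subseteq> ?A" for A
      using b \<alpha> fin that by (intro prod_walsh_weight_summable) auto
    have abs: "(\<lambda>h. norm (kernel_term b \<alpha> u x y h)) summable_on A" if "A \<subseteq> ?A" for A
      using sumW[OF that] by (simp add: norm_kernel_term)
    note sumT = abs_summable_summable[OF abs]
    have "(\<Sum>\<^sub>\<infinity>h\<in>?A. kernel_term b \<alpha> u x y h) - (\<Sum>h\<in>?B. kernel_term b \<alpha> u x y h) =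
        infsum (kernel_term b \<alpha> u x y) (?A - ?B)"
      using B by (subst infsum_Diff) (auto intro!: sumT)
    also have "cmod \<dots> \<le> (\<Sum>\<^sub>\<infinity>h\<in>?A - ?B. norm (kernel_term b \<alpha> u x y h))"
      by (rule norm_infsum_bound) (rule abs, blast)
    also have "\<dots> = (\<Sum>\<^sub>\<infinity>h\<in>?A - ?B. \<Prod>j\<in>u. walsh_weight b \<alpha> (h j))"
      by (simp add: norm_kernel_term)
    also have "\<dots> = (\<Sum>\<^sub>\<infinity>h\<in>?A. \<Prod>j\<in>u. walsh_weight b \<alpha> (h j)) - (\<Sum>h\<in>?B. \<Prod>j\<in>u. walsh_weight b \<alpha> (h j))"
      using B by (subst infsum_Diff) (auto intro!: sumW)
    finally show ?thesis .
  qed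
  have "walsh_kernel b \<alpha> \<gamma> s x y - walsh_kernel_trunc b \<alpha> \<gamma> s L x y =
      (\<Sum>u\<in>?U. of_real (\<gamma> u) * ((\<Sum>\<^sub>\<infinity>h\<in>(\<Pi>\<^sub>E j\<in>u. {1..}). kernel_term b \<alpha> u x y h) - (\<Sum>h\<in>freq_box b u L. kernel_term b \<alpha> u x y h)))"
    by (simp add: walsh_kernel_eq walsh_kernel_trunc_def sum_subtractf right_diff_distrib)
  also have "cmod \<dots> \<le> kernel_tail b \<alpha> \<gamma> s L"
    unfolding kernel_tail_def
  proof (rule sum_norm_le)
    fix u assume u: "u \<in> ?U"
    then have "\<gamma> u \<ge> 0" using \<gamma> by blast
    then show "cmod (of_real (\<gamma> u) * ((\<Sum>\<^sub>\<infinity>h\<in>(\<Pi>\<^sub>E j\<in>u. {1..}). kernel_term b \<alpha> u x y h) - (\<Sum>h\<in>freq_box b u L. kernel_term b \<alpha> u x y h)))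
      \<le> \<gamma> u * ((\<Sum>\<^sub>\<infinity>h\<in>(\<Pi>\<^sub>E j\<in>u. {1..}). \<Prod>j\<in>u. walsh_weight b \<alpha> (h j)) - (\<Sum>h\<in>freq_box b u L. \<Prod>j\<in>u. walsh_weight b \<alpha> (h j)))"
      unfolding norm_mult using dist[OF u] by (intro mult_mono) auto
  qed
  finally show ?thesis .
qed

lemma kernel_tail_tendsto:
  assumes "b \<ge> 2" "\<alpha> > 1"
  shows "kernel_tail b \<alpha> \<gamma> s \<longlonglongrightarrow> 0"
proof -
  have "(\<lambda>L. \<gamma> u * ((\<Sum>\<^sub>\<infinity>h\<in>(\<Pi>\<^sub>E j\<in>u. {1..}). \<Prod>j\<in>u. walsh_weight b \<alpha> (h j)) -
        (\<Sum>h\<in>freq_box b u L. \<Prod>j\<in>u. walsh_weight b \<alpha> (h j)))) \<longlonglongrightarrow> 0"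
    if "u \<subseteq> {1..s}" for u
  proof -
    have u: "finite u" using that finite_subset by auto
    have "(\<lambda>L. \<Sum>h\<in>freq_box b u L. \<Prod>j\<in>u. walsh_weight b \<alpha> (h j)) \<longlonglongrightarrow>
        (\<Sum>\<^sub>\<infinity>h\<in>(\<Pi>\<^sub>E j\<in>u. {1..}). \<Prod>j\<in>u. walsh_weight b \<alpha> (h j))"
      using freq_box_sum_tendsto[OF assms(1) u subset_refl prod_walsh_weight_summable[OF assms u subset_refl]]
      unfolding Int_absorb2[OF freq_box_subset] .
    then show ?thesis
      by (intro tendsto_mult_right_zero) (use LIM_zero tendsto_minus in fastforce)
  qed
  then have "kernel_tail b \<alpha> \<gamma> s \<longlonglongrightarrow> (\<Sum>u\<in>{u. u \<noteq> {} \<and> u \<subseteq> {1..s}}. 0)"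
    unfolding kernel_tail_def by (intro tendsto_sum) auto
  then show ?thesis by simp
qed

lemma walsh_kernel_trunc_tendsto:
  assumes "b \<ge> 2" "\<alpha> > 1" "\<And>u. u \<subseteq> {1..s} \<Longrightarrow> \<gamma> u \<ge> 0"
  shows "(\<lambda>L. walsh_kernel_trunc b \<alpha> \<gamma> s L x y) \<longlonglongrightarrow> walsh_kernel b \<alpha> \<gamma> s x y"
proof (rule LIM_zero_cancel, rule Lim_null_comparison[OF _ kernel_tail_tendsto[OF assms(1,2)]])
  show "\<forall>\<^sub>F L in sequentially. norm (walsh_kernel_trunc b \<alpha> \<gamma> s L x y - walsh_kernel b \<alpha> \<gamma> s x y) \<le> kernel_tail b \<alpha> \<gamma> s L"
    using walsh_kernel_trunc_dist[where s = s and \<gamma> = \<gamma>, OF assms] by (simp add: norm_minus_commute)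
qed

lemma kernel_diag_bound:
  assumes "b \<ge> 2" "\<alpha> > 1" "\<And>u. u \<subseteq> {1..s} \<Longrightarrow> \<gamma> u \<ge> 0"
  shows "Re (walsh_kernel b \<alpha> \<gamma> s x x) \<le> 1 + kernel_tail b \<alpha> \<gamma> s 0"
proof -
  \<comment> \<open>At level 0 the range from 1 to below b^0 is empty, so for nonempty u no
    frequency remains.\<close>
  have "walsh_kernel_trunc b \<alpha> \<gamma> s 0 x x = 1"
    unfolding walsh_kernel_trunc_def
    by (auto intro!: sum.neutral simp: freq_box_def PiE_eq_empty_iff)
  then show ?thesis
    using walsh_kernel_trunc_dist[where s = s and \<gamma> = \<gamma> and x = x and y = x and L = 0, OF assms] abs_Re_le_cmod[of "walsh_kernel b \<alpha> \<gamma> s x x - 1"]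
    by simp
qed

lemma walsh_kernel_trunc_floor:
  assumes "b \<ge> 2"
  shows "walsh_kernel_trunc b \<alpha> \<gamma> s M (cube_floor b s M x) y = walsh_kernel_trunc b \<alpha> \<gamma> s M x y"
    and "walsh_kernel_trunc b \<alpha> \<gamma> s M x (cube_floor b s M y) = walsh_kernel_trunc b \<alpha> \<gamma> s M x y"
proof -
  have wal: "(\<Prod>j\<in>u. wal b (h j) (cube_floor b s M x j)) = (\<Prod>j\<in>u. wal b (h j) (x j))"
    if "u \<subseteq> {1..s}" "h \<in> freq_box b u M" for u h x
  proof (intro prod.cong refl)
    fix j assume "j \<in> u"
    then have "j \<in> {1..s}" "h j \<ge> 1" "h j < b ^ M"
      using that by (auto simp: freq_box_def PiE_iff)
    then show "wal b (h j) (cube_floor b s M x j) = wal b (h j) (x j)"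
      using wal_floor_grid[OF assms] by (simp add: cube_floor_def)
  qed
  show "walsh_kernel_trunc b \<alpha> \<gamma> s M (cube_floor b s M x) y = walsh_kernel_trunc b \<alpha> \<gamma> s M x y"
    unfolding walsh_kernel_trunc_def kernel_term_def by (simp add: wal)
  show "walsh_kernel_trunc b \<alpha> \<gamma> s M x (cube_floor b s M y) = walsh_kernel_trunc b \<alpha> \<gamma> s M x y"
    unfolding walsh_kernel_trunc_def kernel_term_def by (simp add: wal)
qed

text \<open>All four truncated kernel values coincide and cancel in the alternating sum; each of the
  four errors is at most one tail.\<close>

lemma walsh_kernel_floor_dist:
  fixes \<gamma> :: "nat set \<Rightarrow> real"
  assumes "b \<ge> 2" "\<alpha> > 1" "\<And>u. u \<subseteq> {1..s} \<Longrightarrow> \<gamma> u \<ge> 0"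
  defines "K \<equiv> walsh_kernel b \<alpha> \<gamma> s"
  assumes "y = cube_floor b s M x"
  shows "Re (K x x - K x y - K y x + K y y) \<le> 4 * kernel_tail b \<alpha> \<gamma> s M"
proof -
  define T where "T = walsh_kernel_trunc b \<alpha> \<gamma> s M x x"
  have T: "walsh_kernel_trunc b \<alpha> \<gamma> s M x y = T" "walsh_kernel_trunc b \<alpha> \<gamma> s M y x = T"
    "walsh_kernel_trunc b \<alpha> \<gamma> s M y y = T"
    using assms by (simp_all add: walsh_kernel_trunc_floor T_def)
  note dist = walsh_kernel_trunc_dist[where s = s and \<gamma> = \<gamma> and L = M, OF assms(1-3), folded K_def]
  have "\<bar>Re (K p q - T)\<bar> \<le> kernel_tail b \<alpha> \<gamma> s M" if "p \<in> {x, y}" "q \<in> {x, y}" for p q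
    using dist[where x = p and y = q] that T abs_Re_le_cmod[of "K p q - T"] T_def by auto
  from this[of x x] this[of x y] this[of y x] this[of y y] show ?thesis by simp
qed

lemma sum_walsh_kernel_trunc:
  assumes "finite I"
  shows "(\<Sum>i\<in>I. walsh_kernel_trunc b \<alpha> \<gamma> s L (x i) (y i)) = of_nat (card I) +
    (\<Sum>u\<in>{u. u \<noteq> {} \<and> u \<subseteq> {1..s}}. of_real (\<gamma> u) *
      (\<Sum>h\<in>freq_box b u L. \<Sum>i\<in>I. kernel_term b \<alpha> u (x i) (y i) h))"
proof -
  have "(\<Sum>i\<in>I. walsh_kernel_trunc b \<alpha> \<gamma> s L (x i) (y i)) = of_nat (card I) +
    (\<Sum>i\<in>I. \<Sum>u\<in>{u. u \<noteq> {} \<and> u \<subseteq> {1..s}}. of_real (\<gamma> u) * (\<Sum>h\<in>freq_box b u L. kernel_term b \<alpha> u (x i) (y i) h))"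
    by (simp add: walsh_kernel_trunc_def sum.distrib)
  also have "(\<Sum>i\<in>I. \<Sum>u\<in>{u. u \<noteq> {} \<and> u \<subseteq> {1..s}}. of_real (\<gamma> u) * (\<Sum>h\<in>freq_box b u L. kernel_term b \<alpha> u (x i) (y i) h)) =
    (\<Sum>u\<in>{u. u \<noteq> {} \<and> u \<subseteq> {1..s}}. \<Sum>i\<in>I. of_real (\<gamma> u) * (\<Sum>h\<in>freq_box b u L. kernel_term b \<alpha> u (x i) (y i) h))"
    by (rule sum.swap)
  also have "\<dots> = (\<Sum>u\<in>{u. u \<noteq> {} \<and> u \<subseteq> {1..s}}. of_real (\<gamma> u) *
      (\<Sum>i\<in>I. \<Sum>h\<in>freq_box b u L. kernel_term b \<alpha> u (x i) (y i) h))"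
    by (simp add: sum_distrib_left)
  also have "\<dots> = (\<Sum>u\<in>{u. u \<noteq> {} \<and> u \<subseteq> {1..s}}. of_real (\<gamma> u) *
      (\<Sum>h\<in>freq_box b u L. \<Sum>i\<in>I. kernel_term b \<alpha> u (x i) (y i) h))"
    by (subst sum.swap) (rule refl)
  finally show ?thesis .
qed

lemma sum_prod_wal_cube_grid:
  assumes u: "u \<noteq> {}" "u \<subseteq> {1..s}" and h: "h \<in> freq_box CARD('b::prime_card) u M"
  shows "(\<Sum>y\<in>cube_grid CARD('b) s M. \<Prod>j\<in>u. wal CARD('b) (h j) (y j)) = 0"
proof -
  let ?b = "CARD('b)"
  obtain j where j: "j \<in> u" using u by auto
  have "(\<Sum>y\<in>cube_grid ?b s M. \<Prod>j\<in>u. wal ?b (h j) (y j)) =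
      (\<Sum>y\<in>cube_grid ?b s M. \<Prod>j=1..s. if j \<in> u then wal ?b (h j) (y j) else 1)"
    using u by (intro sum.cong refl) (simp add: prod.If_cases Int_absorb1)
  also have "\<dots> = (\<Prod>j=1..s. \<Sum>y\<in>grid ?b M. if j \<in> u then wal ?b (h j) y else 1)"
    unfolding cube_grid_def by (subst prod_sum_PiE) auto
  also have "\<dots> = 0"
  proof (rule prod_zero)
    have "1 \<le> h j" "h j < ?b ^ M" using h j by (auto simp: freq_box_def PiE_iff)
    then have "(\<Sum>y\<in>grid ?b M. if j \<in> u then wal ?b (h j) y else 1) = 0"
      using sum_wal_grid[where 'b = 'b] j by simp
    then show "\<exists>j\<in>{1..s}. (\<Sum>y\<in>grid ?b M. if j \<in> u then wal ?b (h j) y else 1) = 0"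
      using j u by blast
  qed simp
  finally show ?thesis .
qed

text \<open>Truncating the kernel at the level of the grid makes every nonconstant term average to
  0. The truncated kernel thus has mean exactly 1, and only the tail is left.\<close>

lemma walsh_kernel_grid_mean:
  assumes b: "b = CARD('b::prime_card)" and \<alpha>: "\<alpha> > 1" and \<gamma>: "\<And>u. u \<subseteq> {1..s} \<Longrightarrow> \<gamma> u \<ge> 0"
  shows "cmod ((\<Sum>y\<in>cube_grid b s M. walsh_kernel b \<alpha> \<gamma> s x y) / of_nat (card (cube_grid b s M)) - 1)
    \<le> kernel_tail b \<alpha> \<gamma> s M"
proof -
  have b2: "b \<ge> 2" using card_ge_2 b by simp
  let ?G = "cube_grid b s M"
  have G: "finite ?G" "?G \<noteq> {}" using cube_grid_nonempty[OF b2] by auto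
  have "(\<Sum>y\<in>?G. kernel_term b \<alpha> u x y h) = 0" if "u \<noteq> {}" "u \<subseteq> {1..s}" "h \<in> freq_box b u M" for u h
  proof -
    have "(\<Sum>y\<in>?G. kernel_term b \<alpha> u x y h) =
        of_real (\<Prod>j\<in>u. walsh_weight b \<alpha> (h j)) * (\<Prod>j\<in>u. wal b (h j) (x j)) *
        cnj (\<Sum>y\<in>?G. \<Prod>j\<in>u. wal b (h j) (y j))"
      unfolding kernel_term_def cnj_sum sum_distrib_left by simp
    also have "(\<Sum>y\<in>?G. \<Prod>j\<in>u. wal b (h j) (y j)) = 0"
      using sum_prod_wal_cube_grid[where 'b = 'b] that unfolding b .
    finally show ?thesis by simp
  qed
  then have trunc: "(\<Sum>y\<in>?G. walsh_kernel_trunc b \<alpha> \<gamma> s M x y) = of_nat (card ?G)"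
    by (subst sum_walsh_kernel_trunc) auto
  have "cmod ((\<Sum>y\<in>?G. walsh_kernel b \<alpha> \<gamma> s x y - walsh_kernel_trunc b \<alpha> \<gamma> s M x y) / of_nat (card ?G) - 0)
      \<le> kernel_tail b \<alpha> \<gamma> s M"
    using walsh_kernel_trunc_dist[where s = s and \<gamma> = \<gamma>, OF b2 \<alpha> \<gamma>] by (intro mean_dist_le G) simp
  then show ?thesis
    using G by (simp add: sum_subtractf trunc diff_divide_distrib)
qed

section \<open>Dual nets and the error formula\<close>

text \<open>The set D_u of the error formula, with the congruence to 0 modulo x^m written as
  divisibility.\<close>

definition dual_net :: "nat \<Rightarrow> nat set \<Rightarrow> (nat \<Rightarrow> 'b::prime_card mod_ring poly) \<Rightarrow> (nat \<Rightarrow> nat) set" where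
  "dual_net m u v = {h \<in> (\<Pi>\<^sub>E j\<in>u. {1..}). Polynomial.monom 1 m dvd (\<Sum>j\<in>u. trunc_poly m (h j) * v j)}"

definition dual_sum :: "real \<Rightarrow> nat \<Rightarrow> nat set \<Rightarrow> (nat \<Rightarrow> 'b::prime_card mod_ring poly) \<Rightarrow> real" where
  "dual_sum \<alpha> m u v = (\<Sum>\<^sub>\<infinity>h\<in>dual_net m u v. \<Prod>j\<in>u. walsh_weight CARD('b) \<alpha> (h j))"

lemma dual_net_subset: "dual_net m u v \<subseteq> (\<Pi>\<^sub>E j\<in>u. {1..})"
  by (auto simp: dual_net_def)

lemma dual_sum_tendsto:
  fixes v :: "nat \<Rightarrow> 'b::prime_card mod_ring poly"
  assumes "finite u" "\<alpha> > 1"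
  shows "(\<lambda>L. \<Sum>h\<in>freq_box CARD('b) u L \<inter> dual_net m u v. \<Prod>j\<in>u. walsh_weight CARD('b) \<alpha> (h j))
    \<longlonglongrightarrow> dual_sum \<alpha> m u v"
  unfolding dual_sum_def using assms
  by (intro freq_box_sum_tendsto prod_walsh_weight_summable dual_net_subset card_ge_2)

lemma sum_wal_lattice_points:
  fixes v :: "nat \<Rightarrow> 'b::prime_card mod_ring poly"
  assumes "m \<ge> 1" "u \<subseteq> {1..s}" "h \<in> freq_box CARD('b) u L"
  shows "(\<Sum>n | degree n < m. \<Prod>j\<in>u. wal CARD('b) (h j) (lattice_point s m v n j)) =
    (if h \<in> dual_net m u v then of_nat (CARD('b) ^ m) else 0)"
proof -
  have "(\<Sum>n | degree n < m. \<Prod>j\<in>u. wal CARD('b) (h j) (lattice_point s m v n j)) =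
      (\<Sum>n | degree n < m. \<Prod>j\<in>u. wal CARD('b) (h j) (nu m (n * v j)))"
    using assms(2) by (intro sum.cong prod.cong refl) (auto simp: lattice_point_def)
  also have "\<dots> = (if Polynomial.monom 1 m dvd (\<Sum>j\<in>u. trunc_poly m (h j) * v j) then of_nat (CARD('b) ^ m) else 0)"
    using assms(1) by (simp only: prod_wal_lattice sum_mod_char_coeff)
  finally show ?thesis
    using subsetD[OF freq_box_subset assms(3)] by (simp add: dual_net_def)
qed

text \<open>For each frequency the double sum over the nodes is a character sum times its conjugate.
  It equals the squared number of nodes on the dual net and 0 off it.\<close>

lemma kernel_trunc_lattice_mean:
  fixes s :: nat and v :: "nat \<Rightarrow> 'b::prime_card mod_ring poly"
  assumes m: "m \<ge> 1"
  defines "b \<equiv> CARD('b)" and "P \<equiv> {n :: 'b mod_ring poly. degree n < m}" and "p \<equiv> lattice_point s m v"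
  shows "(\<Sum>n'\<in>P. \<Sum>n\<in>P. walsh_kernel_trunc b \<alpha> \<gamma> s L (p n') (p n)) / (of_nat (card P))\<^sup>2 =
    1 + (\<Sum>u\<in>{u. u \<noteq> {} \<and> u \<subseteq> {1..s}}. of_real (\<gamma> u) *
      of_real (\<Sum>h\<in>freq_box b u L \<inter> dual_net m u v. \<Prod>j\<in>u. walsh_weight b \<alpha> (h j)))"
proof -
  let ?U = "{u. u \<noteq> {} \<and> u \<subseteq> {1..s}}"
  define N :: complex where "N = of_nat (card P)"
  have card: "card P = b ^ m" unfolding P_def b_def using m by (rule card_polys_degree_less)
  have N0: "N \<noteq> 0" unfolding N_def card b_def by simp
  have fin: "finite P" by (simp add: P_def)
  have pair_sum: "(\<Sum>(n', n)\<in>P \<times> P. kernel_term b \<alpha> u (p n') (p n) h) =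
      (if h \<in> dual_net m u v then of_real (\<Prod>j\<in>u. walsh_weight b \<alpha> (h j)) * N\<^sup>2 else 0)"
    if "u \<in> ?U" "h \<in> freq_box b u L" for u h
  proof -
    define A where "A n = (\<Prod>j\<in>u. wal b (h j) (p n j))" for n
    have A: "(\<Sum>n\<in>P. A n) = (if h \<in> dual_net m u v then N else 0)"
      unfolding A_def P_def p_def N_def card unfolding b_def
      using that m by (subst sum_wal_lattice_points[where L = L]) (auto simp: b_def card_polys_degree_less)
    have "(\<Sum>(n', n)\<in>P \<times> P. kernel_term b \<alpha> u (p n') (p n) h) =
        of_real (\<Prod>j\<in>u. walsh_weight b \<alpha> (h j)) * ((\<Sum>n'\<in>P. A n') * cnj (\<Sum>n\<in>P. A n))"
      unfolding kernel_term_def A_def[symmetric] cnj_sum sum_product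
      by (simp add: sum.cartesian_product sum_distrib_left case_prod_unfold mult.assoc)
    then show ?thesis by (simp add: A power2_eq_square N_def)
  qed
  have "(\<Sum>n'\<in>P. \<Sum>n\<in>P. walsh_kernel_trunc b \<alpha> \<gamma> s L (p n') (p n)) =
      (\<Sum>i\<in>P \<times> P. walsh_kernel_trunc b \<alpha> \<gamma> s L (p (fst i)) (p (snd i)))"
    by (simp add: sum.cartesian_product case_prod_unfold)
  also have "\<dots> = N\<^sup>2 + (\<Sum>u\<in>?U. of_real (\<gamma> u) * (\<Sum>h\<in>freq_box b u L.
      (\<Sum>(n', n)\<in>P \<times> P. kernel_term b \<alpha> u (p n') (p n) h)))"
    using fin by (subst sum_walsh_kernel_trunc)
      (auto simp: N_def card_cartesian_product power2_eq_square case_prod_unfold)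
  also have "\<dots> = N\<^sup>2 + (\<Sum>u\<in>?U. of_real (\<gamma> u) *
      (of_real (\<Sum>h\<in>freq_box b u L \<inter> dual_net m u v. \<Prod>j\<in>u. walsh_weight b \<alpha> (h j)) * N\<^sup>2))"
  proof -
    have "(\<Sum>h\<in>freq_box b u L. (\<Sum>(n', n)\<in>P \<times> P. kernel_term b \<alpha> u (p n') (p n) h)) =
        of_real (\<Sum>h\<in>freq_box b u L \<inter> dual_net m u v. \<Prod>j\<in>u. walsh_weight b \<alpha> (h j)) * N\<^sup>2"
      if u: "u \<in> ?U" for u
    proof -
      have "finite u" using u finite_subset[of u "{1..s}"] by simp
      then have "finite (freq_box b u L)" by simp
      then show ?thesis
        using u by (simp add: pair_sum sum.If_cases Int_def sum_distrib_right del: of_real_prod)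
    qed
    then show ?thesis by simp
  qed
  also have "\<dots> = N\<^sup>2 * (1 + (\<Sum>u\<in>?U. of_real (\<gamma> u) *
      of_real (\<Sum>h\<in>freq_box b u L \<inter> dual_net m u v. \<Prod>j\<in>u. walsh_weight b \<alpha> (h j))))"
    by (simp add: distrib_left sum_distrib_left mult_ac del: of_real_sum of_real_prod)
  finally show ?thesis using N0 by (simp add: N_def[symmetric] del: of_real_sum of_real_prod)
qed

lemma lattice_point_mem: "lattice_point s m v n \<in> unit_cube s"
proof -
  have "nu m (n * v j) \<in> {0..<1}" for j
    by (rule subsetD[OF grid_subset[OF card_ge_2] nu_mem])
  then show ?thesis by (simp add: lattice_point_def unit_cube_def)
qed

text \<open>The kernel diagonal supplies the uniform bound for dominated convergence, and the
  distance between the kernel sections at x and at its truncation supplies pointwise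
  convergence.\<close>

lemma walsh_space_integral_tendsto:
  assumes rkhs: "rkhs (unit_cube s) (walsh_kernel b \<alpha> \<gamma> s) H ip"
    and b: "b \<ge> 2" and \<alpha>: "\<alpha> > 1" and \<gamma>: "\<And>u. u \<subseteq> {1..s} \<Longrightarrow> \<gamma> u \<ge> 0"
    and f: "f \<in> H"
  shows "(\<lambda>M. (\<Sum>y\<in>cube_grid b s M. f y) / of_nat (card (cube_grid b s M)))
    \<longlonglongrightarrow> (LINT x:unit_cube s|(\<Pi>\<^sub>M j\<in>{1..s}. lborel). f x)"
proof (rule grid_means_tendsto_integral[OF b])
  interpret rkhs "unit_cube s" "walsh_kernel b \<alpha> \<gamma> s" H ip by (rule rkhs)
  let ?K = "walsh_kernel b \<alpha> \<gamma> s"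
  fix x assume x: "x \<in> unit_cube s"
  show "cmod (f x) \<le> ip_norm ip f * sqrt (1 + kernel_tail b \<alpha> \<gamma> s 0)"
    by (rule order.trans[OF norm_le_norm_mult_sqrt_kernel[OF f x]])
       (intro mult_left_mono real_sqrt_le_mono kernel_diag_bound ip_norm_nonneg f b \<alpha> \<gamma>)
  show "(\<lambda>M. f (cube_floor b s M x)) \<longlonglongrightarrow> f x"
  proof (rule LIM_zero_cancel, rule Lim_null_comparison)
    have "cmod (f x - f (cube_floor b s M x)) \<le> ip_norm ip f * sqrt (4 * kernel_tail b \<alpha> \<gamma> s M)" for M
    proof -
      let ?y = "cube_floor b s M x"
      have y: "?y \<in> unit_cube s" using cube_floor_mem[OF b x] cube_grid_subset[OF b] by auto
      have "cmod (f x - f ?y) \<le> ip_norm ip f * sqrt (Re (?K x x - ?K x ?y - ?K ?y x + ?K ?y ?y))"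
        using x y by (intro dist_le_norm_mult_sqrt_kernel f)
      also have "\<dots> \<le> ip_norm ip f * sqrt (4 * kernel_tail b \<alpha> \<gamma> s M)"
        by (intro mult_left_mono real_sqrt_le_mono walsh_kernel_floor_dist ip_norm_nonneg f b \<alpha> \<gamma> refl)
      finally show ?thesis .
    qed
    then show "\<forall>\<^sub>F M in sequentially. norm (f (cube_floor b s M x) - f x) \<le> ip_norm ip f * sqrt (4 * kernel_tail b \<alpha> \<gamma> s M)"
      by (simp add: norm_minus_commute)
    have "(\<lambda>M. ip_norm ip f * sqrt (4 * kernel_tail b \<alpha> \<gamma> s M)) \<longlonglongrightarrow> ip_norm ip f * sqrt (4 * 0)"
      by (intro tendsto_intros kernel_tail_tendsto b \<alpha>)
    then show "(\<lambda>M. ip_norm ip f * sqrt (4 * kernel_tail b \<alpha> \<gamma> s M)) \<longlonglongrightarrow> 0" by simp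
  qed
qed

text \<open>The formula holds for every H and \<open>ip\<close> satisfying the axioms: the
  representer R of the integral reduces the error to a double kernel mean over the nodes, and this
  mean is evaluated by characters.\<close>

theorem worst_case_error_sq:
  fixes v :: "nat \<Rightarrow> 'b::prime_card mod_ring poly"
  assumes b: "b = CARD('b)" and m: "m \<ge> 1" and \<alpha>: "\<alpha> > 1"
    and \<gamma>: "\<And>u. u \<subseteq> {1..s} \<Longrightarrow> \<gamma> u \<ge> 0"
    and rkhs: "rkhs (unit_cube s) (walsh_kernel b \<alpha> \<gamma> s) H ip"
  shows "(worst_case_error H ip s m v)\<^sup>2 = (\<Sum>u\<in>{u. u \<noteq> {} \<and> u \<subseteq> {1..s}}. \<gamma> u * dual_sum \<alpha> m u v)"
proof -
  interpret rkhs "unit_cube s" "walsh_kernel b \<alpha> \<gamma> s" H ip by (rule rkhs)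
  have b2: "b \<ge> 2" using card_ge_2 b by simp
  let ?U = "{u. u \<noteq> {} \<and> u \<subseteq> {1..s}}" and ?K = "walsh_kernel b \<alpha> \<gamma> s"
  define P where "P = {n :: 'b mod_ring poly. degree n < m}"
  define p where "p = lattice_point s m v"
  have P: "finite P" "card P = b ^ m"
    using card_polys_degree_less[OF m, where 'b = 'b] by (simp_all add: P_def b)
  have "0 \<in> P" using m by (simp add: P_def)
  then have P_ne: "P \<noteq> {}" by blast
  have p: "p ` P \<subseteq> unit_cube s" using lattice_point_mem by (auto simp: p_def)
  obtain R where R: "R \<in> H" "\<And>x. x \<in> unit_cube s \<Longrightarrow> R x = 1" "ip R R = 1"
    "\<And>f. f \<in> H \<Longrightarrow> (\<lambda>M. (\<Sum>y\<in>cube_grid b s M. f y) / of_nat (card (cube_grid b s M))) \<longlonglongrightarrow> ip f R"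
  proof (rule mean_representer[of "cube_grid b s" "kernel_tail b \<alpha> \<gamma> s"])
    show "cmod ((\<Sum>y\<in>cube_grid b s M. ?K x y) / of_nat (card (cube_grid b s M)) - 1) \<le> kernel_tail b \<alpha> \<gamma> s M" for M x
      using b \<alpha> \<gamma> by (rule walsh_kernel_grid_mean)
  qed (use cube_grid_nonempty[OF b2] cube_grid_subset[OF b2] kernel_tail_tendsto[OF b2 \<alpha>] in auto)
  have integral: "(LINT x:unit_cube s|(\<Pi>\<^sub>M j\<in>{1..s}. lborel). f x) = ip f R" if "f \<in> H" for f
    using LIMSEQ_unique[OF walsh_space_integral_tendsto[OF rkhs b2 \<alpha> \<gamma> that] R(4)[OF that]] .
  have "worst_case_error H ip s m v =
      (SUP f\<in>{f \<in> H. ip_norm ip f \<le> 1}. cmod (ip f R - (\<Sum>n\<in>P. f (p n)) / of_nat (card P)))"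
    unfolding worst_case_error_def integration_error_def lattice_rule_def P_def[symmetric] p_def[symmetric] P(2) b[symmetric]
    by (intro SUP_cong) (auto simp only: integral mem_Collect_eq)
  then have wce: "(worst_case_error H ip s m v)\<^sup>2 =
      Re ((\<Sum>n'\<in>P. \<Sum>n\<in>P. ?K (p n') (p n)) / (of_nat (card P))\<^sup>2) - 1"
    using quadrature_worst_case_sq[OF R(1-3) P(1) P_ne p] by simp
  \<comment> \<open>With truncated kernels the mean is a finite sum, which can be evaluated exactly.
    As L grows it tends both to the squared error and to the sum over the dual nets.\<close>
  define KL where "KL L = (\<Sum>n'\<in>P. \<Sum>n\<in>P. walsh_kernel_trunc b \<alpha> \<gamma> s L (p n') (p n)) / (of_nat (card P))\<^sup>2" for L
  have "(\<lambda>L. Re (KL L) - 1) \<longlonglongrightarrow> (worst_case_error H ip s m v)\<^sup>2"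
    unfolding wce KL_def using P b2
    by (intro tendsto_intros walsh_kernel_trunc_tendsto b2 \<alpha> \<gamma>) auto
  moreover have "Re (KL L) - 1 = (\<Sum>u\<in>?U. \<gamma> u * (\<Sum>h\<in>freq_box b u L \<inter> dual_net m u v. \<Prod>j\<in>u. walsh_weight b \<alpha> (h j)))" for L
  proof -
    have "KL L = of_real (1 + (\<Sum>u\<in>?U. \<gamma> u * (\<Sum>h\<in>freq_box b u L \<inter> dual_net m u v. \<Prod>j\<in>u. walsh_weight b \<alpha> (h j))))"
      unfolding KL_def P_def p_def b kernel_trunc_lattice_mean[OF m] by simp
    then show ?thesis by (simp only: Re_complex_of_real)
  qed
  moreover have "(\<lambda>L. \<Sum>u\<in>?U. \<gamma> u * (\<Sum>h\<in>freq_box b u L \<inter> dual_net m u v. \<Prod>j\<in>u. walsh_weight b \<alpha> (h j)))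
      \<longlonglongrightarrow> (\<Sum>u\<in>?U. \<gamma> u * dual_sum \<alpha> m u v)"
    unfolding b using \<alpha> by (intro tendsto_intros dual_sum_tendsto) (auto intro: finite_subset)
  ultimately show ?thesis using LIMSEQ_unique by simp
qed

section \<open>Averaging over the search space\<close>

lemma coprime_monom_iff:
  fixes p :: "'a::field_gcd poly"
  assumes "n \<ge> 1"
  shows "coprime p (Polynomial.monom 1 n) \<longleftrightarrow> poly.coeff p 0 \<noteq> 0"
proof
  assume cop: "coprime p (Polynomial.monom 1 n)"
  show "poly.coeff p 0 \<noteq> 0"
  proof
    assume "poly.coeff p 0 = 0"
    then have "Polynomial.monom 1 1 dvd p" by (simp add: monom_1_dvd_iff')
    moreover have "Polynomial.monom 1 1 dvd (Polynomial.monom 1 n :: 'a poly)"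
      using assms by (simp add: monom_1_dvd_iff')
    ultimately have "is_unit (Polynomial.monom 1 1 :: 'a poly)" by (rule coprime_common_divisor[OF cop])
    then show False by (simp add: is_unit_iff_degree degree_monom_eq)
  qed
next
  assume p: "poly.coeff p 0 \<noteq> 0"
  have "coprime p [:0, 1:]"
  proof (rule coprimeI)
    fix d assume d: "d dvd p" "d dvd [:0, 1:]"
    obtain c q where pc: "p = pCons c q" by (cases p)
    \<comment> \<open>A common divisor of p and x also divides the constant term c, which is a
      unit.\<close>
    have "p = [:c:] + [:0, 1:] * q" by (simp add: pc)
    then have "[:c:] = p - [:0, 1:] * q" by simp
    then have "d dvd [:c:]" using dvd_diff[OF d(1) dvd_mult2[OF d(2), of q]] by simp
    moreover have "is_unit [:c:]" using p pc by (simp add: is_unit_const_poly_iff)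
    ultimately show "is_unit d" using dvd_trans by blast
  qed
  then have "coprime p ([:0, 1:] ^ n)" by simp
  then show "coprime p (Polynomial.monom 1 n)" by (simp add: monom_altdef)
qed

lemma coprime_monom:
  fixes p :: "'a::field_gcd poly"
  assumes "poly.coeff p 0 \<noteq> 0"
  shows "coprime p (Polynomial.monom 1 n)"
  using assms coprime_monom_iff[of n p] by (cases n) (auto simp: monom_0 one_pCons[symmetric])

lemma search_space_eq:
  assumes "w < m"
  shows "search_space m w = {g :: 'b::prime_card mod_ring poly. degree g < m - w \<and> poly.coeff g 0 \<noteq> 0}"
  using assms unfolding search_space_def by (auto simp: coprime_monom_iff)

lemma card_search_space:
  assumes "w < m"
  shows "card (search_space m w :: 'b::prime_card mod_ring poly set) = (CARD('b) - 1) * CARD('b) ^ (m - w - 1)"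
proof -
  define A where "A i = (if i = 0 then - {0} else UNIV :: 'b mod_ring set)" for i :: nat
  obtain M' where M': "m - w = Suc M'" using assms by (cases "m - w") auto
  have "search_space m w = {v :: 'b mod_ring poly. degree v < m - w \<and> (\<forall>i<m - w. poly.coeff v i \<in> A i)}"
    using assms by (auto simp: search_space_eq A_def)
  then have "card (search_space m w :: 'b mod_ring poly set) = card (\<Pi>\<^sub>E i\<in>{..<m - w}. A i)"
    using bij_betw_same_card[OF bij_betw_coeffs[of "m - w" A]] assms by simp
  also have "\<dots> = (\<Prod>i<m - w. card (A i))" by (simp add: card_PiE)
  also have "\<dots> = (CARD('b) - 1) * CARD('b) ^ M'"
    unfolding M' by (simp add: prod.lessThan_Suc_shift A_def Compl_eq_Diff_UNIV del: prod.lessThan_Suc)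
  finally show ?thesis by (simp add: M')
qed

lemma finite_search_space [simp]: "finite (search_space m w :: 'b::prime_card mod_ring poly set)"
proof (cases "w < m")
  case True
  show ?thesis unfolding search_space_eq[OF True]
    by (rule finite_subset[OF _ finite_polys_degree_less[of "m - w"]]) auto
qed (simp add: search_space_def)

lemma card_search_space_pos: "card (search_space m w :: 'b::prime_card mod_ring poly set) > 0"
proof (cases "w < m")
  case True
  then show ?thesis using card_ge_2[where 'b = 'b] by (simp add: card_search_space)
qed (simp add: search_space_def)

text \<open>
  A solution determines the multiplicity of \<open>x\<close> in the truncation of \<open>k\<close> (as long as it is
  smaller than \<open>m - w\<close>), because \<open>q\<close> is invertible modulo powers of \<open>x\<close>.
\<close>
lemma power_dvd_frequency_iff:
  fixes q R :: "'b::prime_card mod_ring poly"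
  assumes w: "w < m" and q: "poly.coeff q 0 \<noteq> 0" and t: "t \<le> m - w"
    and sol: "Polynomial.monom 1 m dvd trunc_poly m k * (Polynomial.monom 1 w * q) + R"
  shows "CARD('b) ^ t dvd k \<longleftrightarrow> Polynomial.monom 1 (t + w) dvd R"
proof -
  let ?X = "\<lambda>n. Polynomial.monom 1 n :: 'b mod_ring poly"
  have "?X (t + w) dvd ?X m" using t w by (simp add: monom_1_dvd_iff')
  then have "?X (t + w) dvd trunc_poly m k * (?X w * q) + R" using sol dvd_trans by blast
  then have "?X (t + w) dvd R \<longleftrightarrow> ?X (t + w) dvd trunc_poly m k * (?X w * q)"
    by (metis dvd_add_right_iff add.commute)
  also have "\<dots> \<longleftrightarrow> ?X w * ?X t dvd ?X w * (trunc_poly m k * q)"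
    by (simp add: mult_monom mult_ac add.commute)
  also have "\<dots> \<longleftrightarrow> ?X t dvd trunc_poly m k * q" by simp
  also have "\<dots> \<longleftrightarrow> ?X t dvd trunc_poly m k"
    using coprime_monom[OF q] by (intro coprime_dvd_mult_left_iff) (simp add: coprime_commute)
  also have "\<dots> \<longleftrightarrow> CARD('b) ^ t dvd k"
    using t w by (intro monom_dvd_trunc_poly_iff) simp
  finally show ?thesis by simp
qed

text \<open>If x occurs in the truncation of k with multiplicity r <= t, any two solutions agree
  modulo x^(m-w-r), hence modulo x^(m-w-t). As the degree is below m - w, only the top t
  coefficients remain free.\<close>

lemma card_solutions_le:
  fixes R :: "'b::prime_card mod_ring poly"
  assumes w: "w < m" and t: "t < m - w" and k: "\<not> CARD('b) ^ Suc t dvd k"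
  shows "card {q \<in> search_space m w. Polynomial.monom 1 m dvd trunc_poly m k * (Polynomial.monom 1 w * q) + R}
    \<le> CARD('b) ^ t"
proof -
  let ?X = "\<lambda>n. Polynomial.monom 1 n :: 'b mod_ring poly"
  define M where "M = m - w"
  define a :: "'b mod_ring poly" where "a = trunc_poly m k"
  define Q where "Q = {q \<in> search_space m w. ?X m dvd a * (?X w * q) + R}"
  have "\<not> ?X (Suc t) dvd a"
    unfolding a_def using k t w by (subst monom_dvd_trunc_poly_iff) auto
  then obtain i where i: "i < Suc t" "poly.coeff a i \<noteq> 0" by (auto simp: monom_1_dvd_iff')
  \<comment> \<open>The exact multiplicity of x in a; the cofactor a' then has nonzero constant
    coefficient and is coprime to all powers of x.\<close>
  define r where "r = (LEAST i. poly.coeff a i \<noteq> 0)"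
  have r: "poly.coeff a r \<noteq> 0" "r \<le> t"
    unfolding r_def using i LeastI[of "\<lambda>i. poly.coeff a i \<noteq> 0" i] Least_le[of "\<lambda>i. poly.coeff a i \<noteq> 0" i] by auto
  have "?X r dvd a" unfolding monom_1_dvd_iff' r_def using not_less_Least by blast
  then obtain a' where a': "a = ?X r * a'" by (elim dvdE)
  have a'0: "poly.coeff a' 0 \<noteq> 0" using r(1) by (simp add: a' coeff_monom_mult)
  have X_add: "?X (r + w) = ?X r * ?X w" by (simp add: mult_monom)
  have cong: "?X (M - t) dvd q - q'" if "q \<in> Q" "q' \<in> Q" for q q'
  proof -
    have "?X m dvd (a * (?X w * q) + R) - (a * (?X w * q') + R)"
      using that by (intro dvd_diff) (auto simp: Q_def)
    also have "(a * (?X w * q) + R) - (a * (?X w * q') + R) = ?X (r + w) * (a' * (q - q'))"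
      unfolding a' X_add by (simp add: algebra_simps)
    also have "?X m = ?X (r + w) * ?X (M - r)"
      using r t w by (simp add: mult_monom M_def)
    finally have "?X (M - r) dvd a' * (q - q')" by simp
    then have "?X (M - r) dvd q - q'"
      using coprime_monom[OF a'0] by (metis coprime_commute coprime_dvd_mult_right_iff)
    moreover have "?X (M - t) dvd ?X (M - r)" using r by (simp add: monom_1_dvd_iff')
    ultimately show ?thesis using dvd_trans by blast
  qed
  have "inj_on (\<lambda>q. \<lambda>i\<in>{..<t}. poly.coeff q (M - t + i)) Q"
  proof (rule inj_onI)
    fix q q' assume q: "q \<in> Q" "q' \<in> Q"
      and eq: "(\<lambda>i\<in>{..<t}. poly.coeff q (M - t + i)) = (\<lambda>i\<in>{..<t}. poly.coeff q' (M - t + i))"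
    have deg: "degree q < M" "degree q' < M" using q w by (auto simp: Q_def search_space_eq M_def)
    show "q = q'"
    proof (rule poly_eqI)
      fix i
      consider "i < M - t" | "M - t \<le> i" "i < M" | "M \<le> i" by linarith
      then show "poly.coeff q i = poly.coeff q' i"
      proof cases
        case 1
        then show ?thesis using cong[OF q] by (simp add: monom_1_dvd_iff')
      next
        case 2
        then have "i - (M - t) < t" "M - t + (i - (M - t)) = i" using t by (auto simp: M_def)
        then show ?thesis using fun_cong[OF eq, of "i - (M - t)"] by simp
      next
        case 3
        then show ?thesis using deg by (simp add: coeff_eq_0)
      qed
    qed
  qed
  then have "card Q \<le> card (\<Pi>\<^sub>E i\<in>{..<t}. UNIV :: 'b mod_ring set)"
    by (rule card_inj_on_le) (auto simp: finite_PiE split: if_splits)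
  also have "\<dots> = CARD('b) ^ t" by (simp add: card_PiE)
  finally show ?thesis by (simp add: Q_def a_def)
qed

text \<open>The heart of the averaging: R collects the other coordinates. The power of x in R forces
  the power of b in every solvable k, and the small weight of such k offsets the number of solutions
  q.\<close>

lemma sum_search_space_le:
  fixes R :: "'b::prime_card mod_ring poly"
  assumes \<beta>: "\<beta> > 1"
  shows "(\<Sum>q\<in>search_space m w. \<Sum>k | k \<in> {1..<CARD('b) ^ L} \<and>
       Polynomial.monom 1 m dvd trunc_poly m k * (Polynomial.monom 1 w * q) + R. walsh_weight CARD('b) \<beta> k)
    \<le> real (card (search_space m w :: 'b mod_ring poly set)) * (2 * mu CARD('b) \<beta> / real CARD('b) ^ (m - w))"
proof -
  let ?X = "\<lambda>n. Polynomial.monom 1 n :: 'b mod_ring poly"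
  let ?b = "CARD('b)"
  let ?W = "walsh_weight ?b \<beta>"
  define G :: "'b mod_ring poly set" where "G = search_space m w"
  define sol where "sol q k \<longleftrightarrow> ?X m dvd trunc_poly m k * (?X w * q) + R" for q k
  define I where "I = {1..<?b ^ L}"
  define Q where "Q k = {q \<in> G. sol q k}" for k
  have b2: "?b \<ge> 2" by (rule card_ge_2)
  have fin: "finite G" "finite I" by (simp_all add: G_def I_def)
  have mu: "mu ?b \<beta> \<ge> 0" by (rule mu_nonneg)
  have swap: "(\<Sum>q\<in>G. \<Sum>k | k \<in> I \<and> sol q k. ?W k) = (\<Sum>k\<in>I. real (card (Q k)) * ?W k)"
    using fin by (subst sum.swap_restrict) (simp_all add: Q_def)
  have "(\<Sum>k\<in>I. real (card (Q k)) * ?W k) \<le> real (card G) * (2 * mu ?b \<beta> / real ?b ^ (m - w))"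
  proof (cases "w < m")
    \<comment> \<open>For w >= m there is one candidate and the truncated difference m - w is 0, so
      the full sum over k is allowed.\<close>
    case False
    then have "G = {1}" by (simp add: G_def search_space_def)
    then have "Q k \<subseteq> {1}" for k by (auto simp: Q_def)
    then have "card (Q k) \<le> 1" for k using card_mono[of "{1}" "Q k"] by simp
    then have "(\<Sum>k\<in>I. real (card (Q k)) * ?W k) \<le> (\<Sum>k\<in>I. 1 * ?W k)"
      by (intro sum_mono mult_right_mono) auto
    also have "\<dots> \<le> mu ?b \<beta>"
      unfolding mult_1 using b2 \<beta> fin by (intro sum_walsh_weight_le_mu) (auto simp: I_def)
    finally show ?thesis using mu False \<open>G = {1}\<close> by simp
  next
    case True
    define M where "M = m - w"
    have G_coeff: "poly.coeff q 0 \<noteq> 0" if "q \<in> G" for q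
      using that True by (simp add: G_def search_space_eq)
    have dvd_iff: "?b ^ t dvd k \<longleftrightarrow> ?X (t + w) dvd R" if "Q k \<noteq> {}" "t \<le> M" for k t
      using that power_dvd_frequency_iff[OF True G_coeff, of _ t k R] by (auto simp: Q_def sol_def M_def)
    \<comment> \<open>Frequencies not divisible by b^t admit no solution and drop out; c caps the
      number of solutions for the others.\<close>
    have bound: "(\<Sum>k\<in>I. real (card (Q k)) * ?W k) \<le> real c * (mu ?b \<beta> / real ?b ^ t)"
      if t: "t \<le> M" "?X (t + w) dvd R" and c: "\<And>k. Q k \<noteq> {} \<Longrightarrow> card (Q k) \<le> c" for t c
    proof -
      have "(\<Sum>k\<in>I. real (card (Q k)) * ?W k) = (\<Sum>k | k \<in> I \<and> ?b ^ t dvd k. real (card (Q k)) * ?W k)"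
      proof (rule sum.mono_neutral_right)
        show "\<forall>k\<in>I - {k \<in> I. ?b ^ t dvd k}. real (card (Q k)) * ?W k = 0"
        proof
          fix k assume "k \<in> I - {k \<in> I. ?b ^ t dvd k}"
          then have "Q k = {}" using dvd_iff[OF _ t(1), of k] t(2) by blast
          then show "real (card (Q k)) * ?W k = 0" by simp
        qed
      qed (use fin in auto)
      also have "\<dots> \<le> (\<Sum>k | k \<in> I \<and> ?b ^ t dvd k. real c * ?W k)"
      proof (intro sum_mono mult_right_mono)
        fix k show "real (card (Q k)) \<le> real c" using c[of k] by (cases "Q k = {}") auto
      qed simp
      also have "\<dots> = real c * (\<Sum>k | k \<in> I \<and> ?b ^ t dvd k. ?W k)"
        by (simp add: sum_distrib_left)
      also have "\<dots> \<le> real c * (mu ?b \<beta> / real ?b ^ t)"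
        using b2 \<beta> fin by (intro mult_left_mono sum_walsh_weight_multiples_le) (auto simp: I_def)
      finally show ?thesis .
    qed
    show ?thesis
    proof (cases "?X (M + w) dvd R")
      case dvd: True
      have "(\<Sum>k\<in>I. real (card (Q k)) * ?W k) \<le> real (card G) * (mu ?b \<beta> / real ?b ^ M)"
        using fin by (intro bound dvd) (auto intro: card_mono simp: Q_def)
      also have "\<dots> \<le> real (card G) * (2 * mu ?b \<beta> / real ?b ^ M)"
        using mu by (intro mult_left_mono divide_right_mono) auto
      finally show ?thesis by (simp add: M_def)
    next
      case ndvd: False
      have "(\<Sum>k\<in>I. real (card (Q k)) * ?W k) \<le> mu ?b \<beta>"
      proof (cases "?X w dvd R")
        case False
        \<comment> \<open>The term containing q is divisible by x^w, so R would have to be as well;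
          this is the equivalence for exponent 0.\<close>
        then have "Q k = {}" for k using dvd_iff[of k 0] by auto
        then show ?thesis using mu by simp
      next
        case dvd: True
        \<comment> \<open>The first failing exponent; its predecessor t is the exact excess of x in
          R over w, so solvable k are divisible by b^t but not by b^(t+1).\<close>
        define n where "n = (LEAST n. \<not> ?X (n + w) dvd R)"
        have n: "\<not> ?X (n + w) dvd R" "n \<le> M"
          unfolding n_def using LeastI[of "\<lambda>n. \<not> ?X (n + w) dvd R", OF ndvd]
            Least_le[of "\<lambda>n. \<not> ?X (n + w) dvd R", OF ndvd] by auto
        obtain t where t: "n = Suc t" using n dvd by (cases n) auto
        have "?X (t + w) dvd R"
          using not_less_Least[of t "\<lambda>n. \<not> ?X (n + w) dvd R"] t by (simp add: n_def)
        moreover have "card (Q k) \<le> ?b ^ t" if "Q k \<noteq> {}" for k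
        proof -
          have "\<not> ?b ^ Suc t dvd k" using dvd_iff[OF that, of "Suc t"] n t by simp
          then show ?thesis
            unfolding Q_def G_def sol_def using n t True by (intro card_solutions_le) (auto simp: M_def)
        qed
        ultimately have "(\<Sum>k\<in>I. real (card (Q k)) * ?W k) \<le> real (?b ^ t) * (mu ?b \<beta> / real ?b ^ t)"
          using n t by (intro bound) auto
        then show ?thesis by simp
      qed
      also have "mu ?b \<beta> \<le> real (card G) * (2 * mu ?b \<beta> / real ?b ^ (m - w))"
      proof -
        have "m - w = Suc (m - w - 1)" using True by simp
        then have pow: "real ?b ^ (m - w) = real ?b * real ?b ^ (m - w - 1)" by (metis power_Suc)
        \<comment> \<open>The origin of the factor 2: for b >= 2 the ratio b / (b - 1) of b^(m-w) to
          the size of the search space is at most 2.\<close>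
        have "real ?b * 1 \<le> 2 * real (?b - 1)" using b2 by simp
        then have "mu ?b \<beta> * real ?b \<le> mu ?b \<beta> * (2 * real (?b - 1))"
          using mu by (intro mult_left_mono) auto
        moreover have "real (card G) * (2 * mu ?b \<beta> / real ?b ^ (m - w)) = mu ?b \<beta> * (2 * real (?b - 1)) / real ?b"
          unfolding G_def card_search_space[OF True] pow of_nat_mult of_nat_power using b2 by simp
        ultimately show ?thesis using b2 by (simp only:) (subst pos_le_divide_eq, auto)
      qed
      finally show ?thesis .
    qed
  qed
  then show ?thesis unfolding swap[symmetric] unfolding G_def sol_def I_def .
qed

section \<open>From one coordinate to all coordinate sets\<close>

lemma sum_freq_box_insert:
  assumes "d \<notin> u"
  shows "(\<Sum>h\<in>freq_box b (insert d u) L. f h) = (\<Sum>h\<in>freq_box b u L. \<Sum>k\<in>{1..<b ^ L}. f (h(d := k)))"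
proof -
  have "(\<Sum>h\<in>freq_box b (insert d u) L. f h) = (\<Sum>(k, h)\<in>{1..<b ^ L} \<times> freq_box b u L. f (h(d := k)))"
    unfolding freq_box_def PiE_insert_eq
    by (subst sum.reindex[OF inj_combinator[OF assms]]) (simp add: case_prod_unfold)
  also have "\<dots> = (\<Sum>k\<in>{1..<b ^ L}. \<Sum>h\<in>freq_box b u L. f (h(d := k)))"
    by (simp add: sum.cartesian_product)
  also have "\<dots> = (\<Sum>h\<in>freq_box b u L. \<Sum>k\<in>{1..<b ^ L}. f (h(d := k)))"
    by (rule sum.swap)
  finally show ?thesis .
qed

text \<open>The frequency in coordinate d is separated from the rest. For fixed other frequencies
  the one-coordinate average applies with a bound that does not depend on them, so the remaining sum
  yields one factor mu per coordinate.\<close>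

lemma sum_dual_net_le:
  fixes v :: "nat \<Rightarrow> 'b::prime_card mod_ring poly"
  assumes u: "finite u" "d \<in> u" and \<beta>: "\<beta> > 1"
  shows "(\<Sum>q\<in>search_space m w. \<Sum>h\<in>freq_box CARD('b) u L \<inter> dual_net m u (v(d := Polynomial.monom 1 w * q)).
       \<Prod>j\<in>u. walsh_weight CARD('b) \<beta> (h j))
    \<le> real (card (search_space m w :: 'b mod_ring poly set)) *
      (2 * mu CARD('b) \<beta> ^ card u / real CARD('b) ^ (m - w))"
proof -
  let ?X = "\<lambda>n. Polynomial.monom 1 n :: 'b mod_ring poly"
  let ?b = "CARD('b)"
  let ?W = "walsh_weight ?b \<beta>"
  define G :: "'b mod_ring poly set" where "G = search_space m w"
  define u' where "u' = u - {d}"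
  have u': "finite u'" "d \<notin> u'" "u = insert d u'" using u by (auto simp: u'_def)
  \<comment> \<open>The contribution of the other coordinates, independent of q and of the frequency
    k in coordinate d.\<close>
  define R where "R h = (\<Sum>j\<in>u'. trunc_poly m (h j) * v j)" for h
  define sol where "sol q h k \<longleftrightarrow> ?X m dvd trunc_poly m k * (?X w * q) + R h" for q h k
  have inner: "(\<Sum>h\<in>freq_box ?b u L \<inter> dual_net m u (v(d := ?X w * q)). \<Prod>j\<in>u. ?W (h j)) =
      (\<Sum>h\<in>freq_box ?b u' L. (\<Prod>j\<in>u'. ?W (h j)) * (\<Sum>k | k \<in> {1..<?b ^ L} \<and> sol q h k. ?W k))" for q
  proof -
    let ?v = "v(d := ?X w * q)"
    have upd: "(h(d := k) \<in> dual_net m u ?v) = sol q h k" "(\<Prod>j\<in>u. ?W ((h(d := k)) j)) = ?W k * (\<Prod>j\<in>u'. ?W (h j))"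
      if "h \<in> freq_box ?b u' L" "k \<in> {1..<?b ^ L}" for h k
    proof -
      have "h(d := k) \<in> freq_box ?b u L"
        using that unfolding u'(3) freq_box_def by (intro PiE_fun_upd)
      then have mem: "h(d := k) \<in> (\<Pi>\<^sub>E j\<in>u. {1..})" using freq_box_subset by blast
      have "(\<Sum>j\<in>u'. trunc_poly m ((h(d := k)) j) * ?v j) = R h"
        unfolding R_def using u'(2) by (intro sum.cong) auto
      then have "(\<Sum>j\<in>u. trunc_poly m ((h(d := k)) j) * ?v j) = trunc_poly m k * (?X w * q) + R h"
        unfolding u'(3) using u'(1,2) by (subst sum.insert) auto
      then show "(h(d := k) \<in> dual_net m u ?v) = sol q h k"
        using mem by (simp add: dual_net_def sol_def)
      have "(\<Prod>j\<in>u'. ?W ((h(d := k)) j)) = (\<Prod>j\<in>u'. ?W (h j))"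
        using u'(2) by (intro prod.cong) auto
      then show "(\<Prod>j\<in>u. ?W ((h(d := k)) j)) = ?W k * (\<Prod>j\<in>u'. ?W (h j))"
        unfolding u'(3) using u'(1,2) by (subst prod.insert) auto
    qed
    have "(\<Sum>h\<in>freq_box ?b u L \<inter> dual_net m u ?v. \<Prod>j\<in>u. ?W (h j)) =
        (\<Sum>h\<in>freq_box ?b u L. if h \<in> dual_net m u ?v then \<Prod>j\<in>u. ?W (h j) else 0)"
      using u by (simp add: sum.inter_restrict)
    also have "\<dots> = (\<Sum>h\<in>freq_box ?b u' L. \<Sum>k\<in>{1..<?b ^ L}.
        if h(d := k) \<in> dual_net m u ?v then \<Prod>j\<in>u. ?W ((h(d := k)) j) else 0)"
      unfolding u'(3) by (rule sum_freq_box_insert[OF u'(2)])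
    also have "\<dots> = (\<Sum>h\<in>freq_box ?b u' L. \<Sum>k\<in>{1..<?b ^ L}. if sol q h k then ?W k * (\<Prod>j\<in>u'. ?W (h j)) else 0)"
      by (intro sum.cong refl) (simp only: upd)
    also have "\<dots> = (\<Sum>h\<in>freq_box ?b u' L. \<Sum>k | k \<in> {1..<?b ^ L} \<and> sol q h k. ?W k * (\<Prod>j\<in>u'. ?W (h j)))"
      by (intro sum.cong refl sum.inter_filter[symmetric]) simp
    also have "\<dots> = (\<Sum>h\<in>freq_box ?b u' L. (\<Prod>j\<in>u'. ?W (h j)) * (\<Sum>k | k \<in> {1..<?b ^ L} \<and> sol q h k. ?W k))"
      by (simp only: sum_distrib_left mult.commute[of "\<Prod>j\<in>u'. _ j"])
    finally show ?thesis .
  qed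
  have "(\<Sum>q\<in>G. \<Sum>h\<in>freq_box ?b u L \<inter> dual_net m u (v(d := ?X w * q)). \<Prod>j\<in>u. ?W (h j)) =
      (\<Sum>h\<in>freq_box ?b u' L. (\<Prod>j\<in>u'. ?W (h j)) * (\<Sum>q\<in>G. \<Sum>k | k \<in> {1..<?b ^ L} \<and> sol q h k. ?W k))"
    unfolding inner by (subst sum.swap) (simp only: sum_distrib_left)
  also have "\<dots> \<le> (\<Sum>h\<in>freq_box ?b u' L. (\<Prod>j\<in>u'. ?W (h j)) * (real (card G) * (2 * mu ?b \<beta> / real ?b ^ (m - w))))"
    unfolding sol_def G_def by (intro sum_mono mult_left_mono sum_search_space_le \<beta>) simp
  also have "\<dots> = (\<Sum>h\<in>freq_box ?b u' L. \<Prod>j\<in>u'. ?W (h j)) * (real (card G) * (2 * mu ?b \<beta> / real ?b ^ (m - w)))"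
    by (rule sum_distrib_right[symmetric])
  also have "\<dots> \<le> mu ?b \<beta> ^ card u' * (real (card G) * (2 * mu ?b \<beta> / real ?b ^ (m - w)))"
    using u' card_ge_2[where 'b = 'b] \<beta> mu_nonneg[of ?b \<beta>]
    by (intro mult_right_mono sum_prod_walsh_weight_le freq_box_subset) auto
  also have "\<dots> = real (card G) * (2 * mu ?b \<beta> ^ card u / real ?b ^ (m - w))"
    using u' by simp
  finally show ?thesis by (simp add: G_def)
qed

lemma dual_sum_nonneg: "0 \<le> dual_sum \<alpha> m u v"
  unfolding dual_sum_def by (rule infsum_nonneg) simp

text \<open>This locality makes the sets avoiding d constant during step d, and freezes the
  contribution of u once its largest coordinate has been chosen.\<close>

lemma dual_sum_cong:
  assumes "\<And>j. j \<in> u \<Longrightarrow> v j = v' j"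
  shows "dual_sum \<alpha> m u v = dual_sum \<alpha> m u v'"
proof -
  have "dual_net m u v = dual_net m u v'"
    using assms unfolding dual_net_def by simp
  then show ?thesis by (simp add: dual_sum_def)
qed

lemma prod_walsh_weight_powr:
  "(\<Prod>j\<in>u. walsh_weight b \<alpha> (h j)) powr p = (\<Prod>j\<in>u. walsh_weight b (\<alpha> * p) (h j))"
  by (induction u rule: infinite_finite_induct) (auto simp: powr_mult walsh_weight_powr)

text \<open>
  The minimum over the search space is at most the mean; Jensen's inequality
  \<open>(\<Sum>a)^p \<le> \<Sum>a^p\<close> has to be applied before averaging.
\<close>
lemma min_component_le:
  fixes m w :: nat and v :: "nat \<Rightarrow> 'b::prime_card mod_ring poly"
  assumes \<alpha>: "\<alpha> > 1" and p: "1 / \<alpha> < p" "p \<le> 1"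
    and fin: "finite \<U>" "\<And>u. u \<in> \<U> \<Longrightarrow> finite u \<and> d \<in> u"
    and \<gamma>: "\<And>u. u \<in> \<U> \<Longrightarrow> \<gamma> u \<ge> 0"
  defines "T \<equiv> \<lambda>q. \<Sum>u\<in>\<U>. \<gamma> u * dual_sum \<alpha> m u (v(d := Polynomial.monom 1 w * q))"
  assumes min: "\<And>q. q \<in> search_space m w \<Longrightarrow> T q0 \<le> T q"
  shows "T q0 powr p \<le>
    (\<Sum>u\<in>\<U>. \<gamma> u powr p * (2 * mu CARD('b) (\<alpha> * p) ^ card u / real CARD('b) ^ (m - w)))"
proof -
  let ?b = "CARD('b)"
  define G :: "'b mod_ring poly set" where "G = search_space m w"
  define B where "B = (\<Sum>u\<in>\<U>. \<gamma> u powr p * (2 * mu ?b (\<alpha> * p) ^ card u / real ?b ^ (m - w)))"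
  define V where "V q = v(d := Polynomial.monom 1 w * q)" for q
  \<comment> \<open>Box truncation makes the inner sums finite, so subadditivity of the power
    applies termwise; the limit in L is taken after averaging.\<close>
  define TL where "TL L q = (\<Sum>u\<in>\<U>. \<gamma> u * (\<Sum>h\<in>freq_box ?b u L \<inter> dual_net m u (V q). \<Prod>j\<in>u. walsh_weight ?b \<alpha> (h j)))" for L q
  have "0 < 1 / \<alpha>" using \<alpha> by simp
  then have p0: "p > 0" using p(1) by (rule order.strict_trans)
  \<comment> \<open>This is the condition under which the Walsh weights raised to the power p remain
    summable.\<close>
  have \<beta>: "\<alpha> * p > 1" using p(1) \<alpha> by (simp add: field_simps)
  have T_nonneg: "0 \<le> T q" for q
    unfolding T_def using \<gamma> by (intro sum_nonneg mult_nonneg_nonneg dual_sum_nonneg)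
  have TL_nonneg: "0 \<le> TL L q" for L q
    unfolding TL_def using \<gamma> by (intro sum_nonneg mult_nonneg_nonneg) auto
  have TL_lim: "(\<lambda>L. TL L q) \<longlonglongrightarrow> T q" for q
    unfolding TL_def T_def V_def using fin \<alpha> by (intro tendsto_intros dual_sum_tendsto) auto
  have TL_powr: "TL L q powr p \<le> (\<Sum>u\<in>\<U>. \<gamma> u powr p *
      (\<Sum>h\<in>freq_box ?b u L \<inter> dual_net m u (V q). \<Prod>j\<in>u. walsh_weight ?b (\<alpha> * p) (h j)))" for L q
  proof -
    have "TL L q powr p \<le> (\<Sum>u\<in>\<U>. (\<gamma> u * (\<Sum>h\<in>freq_box ?b u L \<inter> dual_net m u (V q). \<Prod>j\<in>u. walsh_weight ?b \<alpha> (h j))) powr p)"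
      unfolding TL_def using \<gamma> fin p p0
      by (intro powr_sum_le_sum_powr mult_nonneg_nonneg sum_nonneg) auto
    also have "\<dots> \<le> (\<Sum>u\<in>\<U>. \<gamma> u powr p *
      (\<Sum>h\<in>freq_box ?b u L \<inter> dual_net m u (V q). (\<Prod>j\<in>u. walsh_weight ?b \<alpha> (h j)) powr p))"
      using \<gamma> fin p p0
      by (intro sum_mono) (auto simp: powr_mult sum_nonneg intro!: mult_left_mono powr_sum_le_sum_powr)
    finally show ?thesis by (simp add: prod_walsh_weight_powr)
  qed
  have sum_TL: "(\<Sum>q\<in>G. TL L q powr p) \<le> real (card G) * B" for L
  proof -
    have "(\<Sum>q\<in>G. TL L q powr p) \<le> (\<Sum>q\<in>G. \<Sum>u\<in>\<U>. \<gamma> u powr p *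
      (\<Sum>h\<in>freq_box ?b u L \<inter> dual_net m u (V q). \<Prod>j\<in>u. walsh_weight ?b (\<alpha> * p) (h j)))"
      by (intro sum_mono TL_powr)
    also have "\<dots> = (\<Sum>u\<in>\<U>. \<gamma> u powr p *
      (\<Sum>q\<in>G. \<Sum>h\<in>freq_box ?b u L \<inter> dual_net m u (V q). \<Prod>j\<in>u. walsh_weight ?b (\<alpha> * p) (h j)))"
      by (subst sum.swap) (simp only: sum_distrib_left)
    also have "\<dots> \<le> (\<Sum>u\<in>\<U>. \<gamma> u powr p * (real (card G) * (2 * mu ?b (\<alpha> * p) ^ card u / real ?b ^ (m - w))))"
      unfolding G_def V_def using fin \<beta> by (intro sum_mono mult_left_mono sum_dual_net_le) auto
    also have "\<dots> = real (card G) * B"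
      by (simp add: B_def sum_distrib_left mult_ac)
    finally show ?thesis .
  qed
  have "(\<lambda>L. \<Sum>q\<in>G. TL L q powr p) \<longlonglongrightarrow> (\<Sum>q\<in>G. T q powr p)"
    using p0 TL_nonneg by (intro tendsto_sum tendsto_powr' TL_lim tendsto_const) auto
  then have "(\<Sum>q\<in>G. T q powr p) \<le> real (card G) * B"
    by (rule LIMSEQ_le_const2) (use sum_TL in auto)
  moreover have "real (card G) * T q0 powr p \<le> (\<Sum>q\<in>G. T q powr p)"
    using min T_nonneg p0 by (intro sum_bounded_below powr_mono2) (auto simp: G_def)
  ultimately have "real (card G) * T q0 powr p \<le> real (card G) * B" by linarith
  then show ?thesis
    using card_search_space_pos[where 'b = 'b, of m w] by (simp add: G_def B_def)
qed

section \<open>The bound for the output of the search\<close>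

text \<open>The natural-number difference \<open>m - w d\<close> is truncated at 0 and thus stands
  for max(0, m - w_d).\<close>

theorem theorem10:
  fixes b m s :: nat
    and \<alpha> lam :: real
    and \<gamma> :: "nat set \<Rightarrow> real"
    and w :: "nat \<Rightarrow> nat"
    and g0 g :: "nat \<Rightarrow> 'b::prime_card mod_ring poly"
    and H :: "((nat \<Rightarrow> real) \<Rightarrow> complex) set"
    and ip :: "((nat \<Rightarrow> real) \<Rightarrow> complex) \<Rightarrow> ((nat \<Rightarrow> real) \<Rightarrow> complex) \<Rightarrow> complex"
  assumes "b = CARD('b)"
    and "m \<ge> 1" and "s \<ge> 1"
    and "\<alpha> > 1"
    and "\<And>u. u \<subseteq> {1..s} \<Longrightarrow> \<gamma> u > 0" and "\<gamma> {} = 1"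
    and "mono_on {1..s} w"
    and "rkhs (unit_cube s) (walsh_kernel b \<alpha> \<gamma> s) H ip"
    and "\<And>j. j \<in> {1..s} \<Longrightarrow> degree (g0 j) < m"
    and "reduced_scs (\<lambda>v. (worst_case_error H ip s m v)\<^sup>2) s m w g0 g"
    and "1 / \<alpha> < lam" and "lam \<le> 1"
  shows "(worst_case_error H ip s m (\<lambda>j. Y_pow w j * g j))\<^sup>2
    \<le> (\<Sum>d=1..s. \<Sum>u | u \<subseteq> {1..s} \<and> d \<in> u.
          \<gamma> u powr lam * (2 * mu b (\<alpha> * lam) ^ card u / real b ^ (m - w d))) powr (1 / lam)"
proof -
  note b = assms(1) and m = assms(2) and \<alpha> = assms(4) and lam = assms(11,12)
  have \<gamma>: "\<gamma> u \<ge> 0" if "u \<subseteq> {1..s}" for u using assms(5)[OF that] by simp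
  have "0 < 1 / \<alpha>" using \<alpha> by simp
  then have lam0: "lam > 0" using lam(1) by (rule order.strict_trans)
  define U where "U = {u. u \<noteq> {} \<and> u \<subseteq> {1..s}}"
  \<comment> \<open>All sets affected by the choice in step d, including those with larger
    coordinates, whose components still come from \<open>g0\<close>.\<close>
  define Ud where "Ud d = {u. u \<subseteq> {1..s} \<and> d \<in> u}" for d
  define E where "E v = (\<Sum>u\<in>U. \<gamma> u * dual_sum \<alpha> m u v)" for v :: "nat \<Rightarrow> 'b mod_ring poly"
  define T where "T d v = (\<Sum>u\<in>Ud d. \<gamma> u * dual_sum \<alpha> m u v)" for d and v :: "nat \<Rightarrow> 'b mod_ring poly"
  define B where "B d = (\<Sum>u\<in>Ud d. \<gamma> u powr lam * (2 * mu b (\<alpha> * lam) ^ card u / real b ^ (m - w d)))" for d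
  have wce: "(worst_case_error H ip s m v)\<^sup>2 = E v" for v
    unfolding E_def U_def by (rule worst_case_error_sq[OF b m \<alpha> \<gamma> assms(8)])
  have finU: "finite U" "finite (Ud d)" for d
    unfolding U_def Ud_def by (auto intro: finite_subset[of _ "Pow {1..s}"])
  have T_nonneg: "0 \<le> T d v" for d v
    unfolding T_def Ud_def using \<gamma> by (intro sum_nonneg mult_nonneg_nonneg dual_sum_nonneg) auto
  have B_nonneg: "0 \<le> B d" for d
    unfolding B_def using mu_nonneg by (intro sum_nonneg mult_nonneg_nonneg divide_nonneg_nonneg) auto
  have step: "T d (scs_candidate w g0 g d (g d)) \<le> B d powr (1 / lam)" if d: "d \<in> {1..s}" for d
  proof -
    \<comment> \<open>The value 0 in position d is only a placeholder; every use overwrites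
      it.\<close>
    define V where "V = scs_candidate w g0 g d 0"
    have cand: "scs_candidate w g0 g d q = V(d := Polynomial.monom 1 (w d) * q)" for q
      by (rule ext) (simp add: V_def scs_candidate_def Y_pow_def)
    \<comment> \<open>Sets avoiding d contribute a constant, so a minimizer of the whole error also
      minimizes the part belonging to d.\<close>
    have E_split: "E (scs_candidate w g0 g d q) = T d (scs_candidate w g0 g d q) + (\<Sum>u\<in>U - Ud d. \<gamma> u * dual_sum \<alpha> m u V)" for q
    proof -
      have "E (scs_candidate w g0 g d q) = T d (scs_candidate w g0 g d q) + (\<Sum>u\<in>U - Ud d. \<gamma> u * dual_sum \<alpha> m u (scs_candidate w g0 g d q))"
        unfolding E_def T_def using finU by (subst sum.subset_diff[of "Ud d" U]) (auto simp: U_def Ud_def)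
      also have "(\<Sum>u\<in>U - Ud d. \<gamma> u * dual_sum \<alpha> m u (scs_candidate w g0 g d q)) = (\<Sum>u\<in>U - Ud d. \<gamma> u * dual_sum \<alpha> m u V)"
      proof (intro sum.cong refl arg_cong2[where f = "(*)"] dual_sum_cong)
        fix u j assume "u \<in> U - Ud d" "j \<in> u"
        then have "j \<noteq> d" by (auto simp: U_def Ud_def)
        then show "scs_candidate w g0 g d q j = V j" by (simp add: cand)
      qed
      finally show ?thesis .
    qed
    have "is_arg_min (\<lambda>q. E (scs_candidate w g0 g d q)) (\<lambda>q. q \<in> search_space m (w d)) (g d)"
      using assms(10) d unfolding reduced_scs_def wce by blast
    then have "E (scs_candidate w g0 g d (g d)) \<le> E (scs_candidate w g0 g d q)" if "q \<in> search_space m (w d)" for q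
      using that by (auto simp: is_arg_min_linorder)
    then have "T d (scs_candidate w g0 g d (g d)) \<le> T d (scs_candidate w g0 g d q)" if "q \<in> search_space m (w d)" for q
      using that unfolding E_split by simp
    then have "T d (scs_candidate w g0 g d (g d)) powr lam \<le> B d"
      unfolding T_def cand B_def b
      using finite_subset[of _ "{1..s}"]
      by (intro min_component_le \<alpha> lam finU) (simp_all add: Ud_def \<gamma>)
    then have "(T d (scs_candidate w g0 g d (g d)) powr lam) powr (1 / lam) \<le> B d powr (1 / lam)"
      using lam0 by (intro powr_mono2) auto
    then show ?thesis using lam0 T_nonneg by (simp add: powr_powr)
  qed
  define v where "v = (\<lambda>j. Y_pow w j * g j)"
  have Max_mem: "Max u \<in> u \<and> Max u \<in> {1..s} \<and> (\<forall>j\<in>u. j \<le> Max u)" if "u \<in> U" for u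
  proof -
    have "finite u" "u \<noteq> {}" "u \<subseteq> {1..s}" using that finite_subset[of u "{1..s}"] by (auto simp: U_def)
    then show ?thesis using Max_in[of u] Max_ge[of u] by blast
  qed
  \<comment> \<open>Each nonempty u is counted once, at its maximum, when all its components have
    their final values.\<close>
  have "E v = (\<Sum>d=1..s. \<Sum>u | u \<in> U \<and> Max u = d. \<gamma> u * dual_sum \<alpha> m u v)"
    unfolding E_def using finU Max_mem by (intro sum.group[symmetric]) auto
  also have "\<dots> \<le> (\<Sum>d=1..s. T d (scs_candidate w g0 g d (g d)))"
  proof (rule sum_mono)
    fix d assume "d \<in> {1..s}"
    have "(\<Sum>u | u \<in> U \<and> Max u = d. \<gamma> u * dual_sum \<alpha> m u v) =
        (\<Sum>u | u \<in> U \<and> Max u = d. \<gamma> u * dual_sum \<alpha> m u (scs_candidate w g0 g d (g d)))"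
    proof (intro sum.cong refl arg_cong2[where f = "(*)"] dual_sum_cong)
      fix u j assume "u \<in> {u. u \<in> U \<and> Max u = d}" "j \<in> u"
      then have "j \<le> d" using Max_mem by auto
      then show "v j = scs_candidate w g0 g d (g d) j"
        by (auto simp: v_def scs_candidate_def)
    qed
    \<comment> \<open>Sets with maximum d form only part of \<open>Ud d\<close>; adding the
      remaining nonnegative terms reaches the quantity controlled in step d.\<close>
    also have "\<dots> \<le> T d (scs_candidate w g0 g d (g d))"
      unfolding T_def
    proof (rule sum_mono2[OF finU(2)])
      show "{u. u \<in> U \<and> Max u = d} \<subseteq> Ud d" using Max_mem by (auto simp: U_def Ud_def)
    qed (auto simp: Ud_def \<gamma> dual_sum_nonneg)
    finally show "(\<Sum>u | u \<in> U \<and> Max u = d. \<gamma> u * dual_sum \<alpha> m u v) \<le> T d (scs_candidate w g0 g d (g d))" .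
  qed
  also have "\<dots> \<le> (\<Sum>d=1..s. B d powr (1 / lam))"
    by (intro sum_mono step)
  also have "\<dots> \<le> (\<Sum>d=1..s. B d) powr (1 / lam)"
    using B_nonneg lam0 lam by (intro sum_powr_le_powr_sum) auto
  finally show ?thesis
    unfolding wce v_def B_def Ud_def .
qed

end
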